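(* Let $f,g,h,R$ satisfy the standing assumptions on the data listed in the context, let $v^*$ be the optimal value function, and let $\Omega\subset\mathbb{R}^{N}$ be a domain containing the origin. Suppose that $v^*$ is (finite and) real-analytic on $\Omega$. Let $v\in C^{1}(\Omega,\mathbb{R})$ be such that (1) $v(x)\ge 0$ for all $x\in\Omega$ and $v(0)=0$; (2) $\bigl\langle f(x)+g(x)u_{v}(x),\nabla v(x)\bigr\rangle + h(x) + \|u_{v}(x)\|_{R}^2 = 0$ for all $x\in\Omega$, where $u_{v}(x) := -\tfrac12\,R^{-1} g(x)^{\top}\nabla v(x)$; (3) $v$ is real-analytic on $\Omega$. Then $v(x)=v^{*}(x)$ for all $x\in\Omega$.
   Context: Let $N,M\in\mathbb{N}$. $\langle\cdot,\cdot\rangle$ is the Euclidean inner product, $\|\cdot\|$ the Euclidean norm, and $\|y\|_A:=\sqrt{\langle y,Ay\rangle}$ for symmetric positive definite $A$. A domain is a nonempty, open, connected subset of $\mathbb{R}^N$. Standing assumptions on the data: $f\in C^1(\mathbb{R}^N,\mathbb{R}^N)$, $g\in C^1(\mathbb{R}^N,\mathbb{R}^{N\times M})$, $h\in C^1(\mathbb{R}^N,\mathbb{R})$, $R\in\mathbb{R}^{M\times M}$ is symmetric positive definite, $f(0)=0$, $h(0)=0$ and $h(x)>0$ for all $x\ne0$. Optimal control problem: let $\mathcal{U}_\infty:=L^\infty([0,\infty);\mathbb{R}^M)$. For $x\in\mathbb{R}^N$ and $\mathbf{u}\in\mathcal{U}_\infty$ let $\mathbf{x}_{\mathbf{u}}(\cdot;x)$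 be the unique maximal Carathéodory solution of $\dot{\mathbf{x}}_{\mathbf{u}}(t;x)=f(\mathbf{x}_{\mathbf{u}}(t;x))+g(\mathbf{x}_{\mathbf{u}}(t;x))\mathbf{u}(t)$, $\mathbf{x}_{\mathbf{u}}(0;x)=x$. Put $$J_\infty(x,\mathbf{u}):=\int_0^\infty h(\mathbf{x}_{\mathbf{u}}(t;x))+\langle\mathbf{u}(t),R\mathbf{u}(t)\rangle\,dt,$$ with $J_\infty(x,\mathbf{u}):=+\infty$ if the trajectory blows up in finite time. The optimal value function is $v^*(x):=\inf_{\mathbf{u}\in\mathcal{U}_\infty}J_\infty(x,\mathbf{u})$ (allowed to be $+\infty$ in general). *)

theory Defs
  imports "HOL-Analysis.Analysis"
begin

section \<open>Smoothness classes\<close>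

text \<open>Intended for open \<open>S\<close>, so that two-sided derivatives are the right notion.\<close>

definition C1_on ::
  "('a::real_normed_vector \<Rightarrow> 'b::real_normed_vector) \<Rightarrow> 'a set \<Rightarrow> bool" where
  "C1_on F S \<longleftrightarrow>
     (\<exists>D. (\<forall>x\<in>S. (F has_derivative blinfun_apply (D x)) (at x)) \<and> continuous_on S D)"

text \<open>
  Local expansion into a power series in several variables. Multi-indices are functions
  \<open>'n \<Rightarrow> nat\<close>; \<open>has_sum\<close> is unconditional, hence (for real terms) absolute, convergence.
\<close>

definition real_analytic_on :: "(real ^ 'n \<Rightarrow> real) \<Rightarrow> (real ^ 'n) set \<Rightarrow> bool" where
  "real_analytic_on F S \<longleftrightarrow>
     (\<forall>c\<in>S. \<exists>r>0. \<exists>a :: ('n \<Rightarrow> nat) \<Rightarrow> real. \<forall>x\<in>ball c r.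
        ((\<lambda>\<alpha>. a \<alpha> * (\<Prod>i\<in>UNIV. (x $ i - c $ i) ^ \<alpha> i)) has_sum F x) UNIV)"

definition gradient :: "('a::real_inner \<Rightarrow> real) \<Rightarrow> 'a \<Rightarrow> 'a" where
  "gradient F x = (THE D. GDERIV F x :> D)"

definition sym_pos_def :: "real ^ 'm ^ 'm \<Rightarrow> bool" where
  "sym_pos_def A \<longleftrightarrow> transpose A = A \<and> (\<forall>y. y \<noteq> 0 \<longrightarrow> 0 < y \<bullet> (A *v y))"

definition weighted_norm :: "real ^ 'm ^ 'm \<Rightarrow> real ^ 'm \<Rightarrow> real" where
  "weighted_norm A y = sqrt (y \<bullet> (A *v y))"

definition feedback ::
  "(real ^ 'n \<Rightarrow> real ^ 'm ^ 'n) \<Rightarrow> real ^ 'm ^ 'm \<Rightarrow> (real ^ 'n \<Rightarrow> real) \<Rightarrow> real ^ 'n \<Rightarrow> real ^ 'm" where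
  "feedback g R v x = (- (1 / 2)) *\<^sub>R (matrix_inv R *v (transpose (g x) *v gradient v x))"

section \<open>Caratheodory solutions\<close>

text \<open>
  Finite families of non-overlapping closed intervals are given as divisions of their union.
\<close>

definition abs_continuous_on :: "real \<Rightarrow> real \<Rightarrow> (real \<Rightarrow> 'a::real_normed_vector) \<Rightarrow> bool" where
  "abs_continuous_on a b y \<longleftrightarrow>
     (\<forall>\<epsilon>>0. \<exists>\<delta>>0. \<forall>D. D division_of \<Union>D \<and> \<Union>D \<subseteq> {a..b} \<and> (\<Sum>K\<in>D. Sup K - Inf K) < \<delta>
        \<longrightarrow> (\<Sum>K\<in>D. norm (y (Sup K) - y (Inf K))) < \<epsilon>)"

definition admissible_controls :: "(real \<Rightarrow> real ^ 'm) set" where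
  "admissible_controls =
     {u. u \<in> borel_measurable (lebesgue_on {0..}) \<and>
         (\<exists>C. AE t in lebesgue_on {0..}. norm (u t) \<le> C)}"

text \<open>
  Solutions live on \<open>[0, T)\<close> with \<open>0 < T \<le> \<infinity>\<close>; the values of \<open>y\<close> outside this interval are
  irrelevant.
\<close>

definition carath_solution ::
  "(real ^ 'n \<Rightarrow> real ^ 'n) \<Rightarrow> (real ^ 'n \<Rightarrow> real ^ 'm ^ 'n) \<Rightarrow> (real \<Rightarrow> real ^ 'm) \<Rightarrow>
   real ^ 'n \<Rightarrow> ereal \<Rightarrow> (real \<Rightarrow> real ^ 'n) \<Rightarrow> bool" where
  "carath_solution f g u x T y \<longleftrightarrow>
     0 < T \<and> y 0 = x \<and>
     (\<forall>b\<ge>0. ereal b < T \<longrightarrow> abs_continuous_on 0 b y) \<and>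
     (AE t in lebesgue_on {t. 0 \<le> t \<and> ereal t < T}.
        (y has_vector_derivative f (y t) + g (y t) *v u t) (at t))"

definition maximal_solution ::
  "(real ^ 'n \<Rightarrow> real ^ 'n) \<Rightarrow> (real ^ 'n \<Rightarrow> real ^ 'm ^ 'n) \<Rightarrow> (real \<Rightarrow> real ^ 'm) \<Rightarrow>
   real ^ 'n \<Rightarrow> ereal \<Rightarrow> (real \<Rightarrow> real ^ 'n) \<Rightarrow> bool" where
  "maximal_solution f g u x T y \<longleftrightarrow>
     carath_solution f g u x T y \<and>
     \<not> (\<exists>T' z. T < T' \<and> carath_solution f g u x T' z \<and>
              (\<forall>t. 0 \<le> t \<and> ereal t < T \<longrightarrow> z t = y t))"

text \<open>
  For \<open>f\<close>, \<open>g\<close> of class \<open>C\<^sup>1\<close> the maximal solution is unique on its interval of existence, so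
  the choice below only concerns irrelevant values outside that interval.
\<close>

definition trajectory ::
  "(real ^ 'n \<Rightarrow> real ^ 'n) \<Rightarrow> (real ^ 'n \<Rightarrow> real ^ 'm ^ 'n) \<Rightarrow> (real \<Rightarrow> real ^ 'm) \<Rightarrow>
   real ^ 'n \<Rightarrow> real \<Rightarrow> real ^ 'n" where
  "trajectory f g u x = (SOME y. \<exists>T. maximal_solution f g u x T y)"

section \<open>Cost and optimal value\<close>

text \<open>
  The running cost is nonnegative under the standing assumptions, so \<open>ennreal\<close> does not truncate.
  Finite-time blow-up means that the maximal solution does not live on all of \<open>[0, \<infinity>)\<close>.
\<close>

definition cost ::
  "(real ^ 'n \<Rightarrow> real ^ 'n) \<Rightarrow> (real ^ 'n \<Rightarrow> real ^ 'm ^ 'n) \<Rightarrow> (real ^ 'n \<Rightarrow> real) \<Rightarrow>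
   real ^ 'm ^ 'm \<Rightarrow> real ^ 'n \<Rightarrow> (real \<Rightarrow> real ^ 'm) \<Rightarrow> ennreal" where
  "cost f g h R x u =
     (if \<exists>y. maximal_solution f g u x \<infinity> y
      then \<integral>\<^sup>+ t. ennreal (h (trajectory f g u x t) + u t \<bullet> (R *v u t)) \<partial>lebesgue_on {0..}
      else \<infinity>)"

definition optimal_value ::
  "(real ^ 'n \<Rightarrow> real ^ 'n) \<Rightarrow> (real ^ 'n \<Rightarrow> real ^ 'm ^ 'n) \<Rightarrow> (real ^ 'n \<Rightarrow> real) \<Rightarrow>
   real ^ 'm ^ 'm \<Rightarrow> real ^ 'n \<Rightarrow> ennreal" where
  "optimal_value f g h R x = (INF u\<in>admissible_controls. cost f g h R x u)"

end

theory Submission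
  imports Defs "HOL-Complex_Analysis.Complex_Analysis"
begin

text \<open>
  Since \<open>v - v\<^sup>*\<close> is real-analytic on a connected set, it suffices to show \<open>v = v\<^sup>*\<close> near \<open>0\<close>.
  The equation (2) makes \<open>v\<close> a Lyapunov function for the closed loop, which therefore stays in a small
  sublevel set; integrating along it gives \<open>v\<^sup>* \<le> v\<close>. As the feedback is only known to be continuous,
  the closed loop is solved by Peano's theorem, while uniqueness is only needed for a given control.
  Conversely, completing the square in (2) gives \<open>v(x) - v(y(t)) \<le> J\<close> along every trajectory \<open>y\<close>
  inside a ball; if the cost is finite, then \<open>y(t)\<close> comes arbitrarily close to \<open>0\<close>, whence \<open>v(x) \<le> J\<close>.
  A trajectory leaving the ball pays at least a fixed amount for crossing an annulus, which exceeds
  \<open>v(x)\<close> for \<open>x\<close> near \<open>0\<close>.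
\<close>

section \<open>The identity theorem for real-analytic functions\<close>

text \<open>\<open>v\<close> satisfies the equation only on \<open>\<Omega>\<close>, while
  trajectories may leave \<open>\<Omega>\<close>; hence the two values are compared only in a small
  ball about 0. The feedback law serves only to produce a curve \<open>y\<close>; afterwards
  \<open>u t = feedback g R v (y t)\<close> is a fixed bounded function of time, and for such a
  control the C1 data \<open>f\<close>, \<open>g\<close> give uniqueness, so \<open>y\<close> is the
  very trajectory whose cost is counted. In the other direction \<open>u\<close> is merely
  measurable and \<open>y\<close> differentiable only almost everywhere, so integrating along
  \<open>v (y t)\<close> takes a fundamental theorem for absolutely continuous functions. The fixed
  price of an escape comes from one estimate on the annulus
  \<open>r / 2 \<le> norm p \<le> r\<close>: the speed \<open>norm (f p + g p *v w)\<close> is at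
  most \<open>C\<close> times the running cost, because \<open>h\<close> is bounded below there and
  the quadratic term in \<open>w\<close> dominates the linear growth of the speed. A displacement of
  \<open>r / 2\<close> therefore costs at least \<open>r / 2 / C\<close>, however quickly it is
  made, and neither the crossing time nor the size of the control enters.\<close>

lemma real_analytic_on_diff:
  assumes "real_analytic_on F S" "real_analytic_on G S"
  shows "real_analytic_on (\<lambda>x. F x - G x) S"
  unfolding real_analytic_on_def
proof
  fix c assume "c \<in> S"
  obtain r a where r: "r > 0" and a: "\<forall>x\<in>ball c r.
        ((\<lambda>\<alpha>. a \<alpha> * (\<Prod>i\<in>UNIV. (x $ i - c $ i) ^ \<alpha> i)) has_sum F x) UNIV"
    using assms(1) \<open>c \<in> S\<close> unfolding real_analytic_on_def by blast
  obtain s b where s: "s > 0" and b: "\<forall>x\<in>ball c s.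
        ((\<lambda>\<alpha>. b \<alpha> * (\<Prod>i\<in>UNIV. (x $ i - c $ i) ^ \<alpha> i)) has_sum G x) UNIV"
    using assms(2) \<open>c \<in> S\<close> unfolding real_analytic_on_def by blast
  have "((\<lambda>\<alpha>. (a \<alpha> - b \<alpha>) * (\<Prod>i\<in>UNIV. (x $ i - c $ i) ^ \<alpha> i)) has_sum F x - G x) UNIV"
    if "x \<in> ball c (min r s)" for x
  proof -
    have "((\<lambda>\<alpha>. - 1 * (b \<alpha> * (\<Prod>i\<in>UNIV. (x $ i - c $ i) ^ \<alpha> i))) has_sum - 1 * G x) UNIV"
      using b that by (intro has_sum_cmult_right) auto
    from has_sum_add[OF _ this] show ?thesis
      using a that by (simp add: left_diff_distrib)
  qed
  then show "\<exists>r>0. \<exists>a. \<forall>x\<in>ball c r.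
        ((\<lambda>\<alpha>. a \<alpha> * (\<Prod>i\<in>UNIV. (x $ i - c $ i) ^ \<alpha> i)) has_sum F x - G x) UNIV"
    using r s by (intro exI[of _ "min r s"] conjI exI[of _ "\<lambda>\<alpha>. a \<alpha> - b \<alpha>"]) auto
qed

text \<open>
  A power series is re-expanded nowhere: along the complexified line through two points of its
  ball it is a locally uniform limit of polynomials, so analytic continuation in one variable applies.
\<close>

lemma power_series_eq_zero_on_ball:
  fixes a :: "('n::finite \<Rightarrow> nat) \<Rightarrow> real" and c p x :: "real ^ 'n"
  assumes F: "\<And>x. x \<in> ball c r \<Longrightarrow>
      ((\<lambda>\<alpha>. a \<alpha> * (\<Prod>i\<in>UNIV. (x $ i - c $ i) ^ \<alpha> i)) has_sum F x) UNIV"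
    and p: "p \<in> ball c r" and "e > 0"
    and zero: "\<And>x. x \<in> ball c r \<Longrightarrow> x \<in> ball p e \<Longrightarrow> F x = 0"
    and x: "x \<in> ball c r"
  shows "F x = 0"
proof -
  \<comment> \<open>\<open>L 0 = p - c\<close> and \<open>L 1 = x - c\<close>: the centre is
    subtracted, so the series is evaluated at the components of \<open>L z\<close>. The norm of
    \<open>complex ^ 'n\<close> is the Euclidean norm of the moduli, so a real parameter lies in
    \<open>S\<close> exactly when its point on the line lies in \<open>ball c r\<close>.\<close>
  define L :: "complex \<Rightarrow> complex ^ 'n" where
    "L z = (\<chi> i. of_real (p $ i - c $ i) + z * of_real (x $ i - p $ i))" for z
  define S where "S = {z. L z \<in> ball 0 r}"
  have contL: "continuous_on UNIV L"
    unfolding L_def by (intro continuous_intros)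
  have "open S"
    unfolding S_def using continuous_open_preimage[OF contL open_UNIV open_ball[of 0 r]]
    by (simp add: vimage_def)
  have "convex S"
  proof (rule convexI)
    fix z w and s t :: real
    assume zw: "z \<in> S" "w \<in> S" and st: "0 \<le> s" "0 \<le> t" "s + t = 1"
    then have t: "s = 1 - t" by simp
    have "L (s *\<^sub>R z + t *\<^sub>R w) = s *\<^sub>R L z + t *\<^sub>R L w"
      unfolding L_def vec_eq_iff t by (simp add: scaleR_conv_of_real[where 'a=complex] algebra_simps)
    also have "\<dots> \<in> ball 0 r"
      using zw st convex_ball[of "0 :: complex ^ 'n" r] unfolding S_def by (intro convexD) auto
    finally show "s *\<^sub>R z + t *\<^sub>R w \<in> S" by (simp add: S_def)
  qed
  then have "connected S" by (rule convex_connected)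
  have real_line: "(of_real t \<in> S \<longleftrightarrow> p + t *\<^sub>R (x - p) \<in> ball c r)" for t
  proof -
    have "norm (L (of_real t)) = norm (p + t *\<^sub>R (x - p) - c)"
    proof -
      have "L (of_real t) $ i = of_real ((p + t *\<^sub>R (x - p) - c) $ i)" for i
        by (simp add: L_def algebra_simps)
      then show ?thesis unfolding norm_vec_def by (simp add: norm_of_real del: of_real_diff of_real_add of_real_mult)
    qed
    then show ?thesis by (simp add: S_def dist_norm norm_minus_commute)
  qed
  define term' where "term' z \<alpha> = of_real (a \<alpha>) * (\<Prod>i\<in>UNIV. (L z $ i) ^ \<alpha> i)" for z \<alpha>
  define G where "G z = infsum (term' z) UNIV" for z
  have G_real: "G (of_real t) = of_real (F (p + t *\<^sub>R (x - p)))" if "of_real t \<in> S" for t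
  proof -
    let ?y = "p + t *\<^sub>R (x - p)"
    have "((\<lambda>\<alpha>. of_real (a \<alpha> * (\<Prod>i\<in>UNIV. (?y $ i - c $ i) ^ \<alpha> i)) :: complex) has_sum of_real (F ?y)) UNIV"
      using F[of ?y] that real_line by (intro has_sum_of_real) auto
    also have "(\<lambda>\<alpha>. of_real (a \<alpha> * (\<Prod>i\<in>UNIV. (?y $ i - c $ i) ^ \<alpha> i))) = term' (of_real t)"
      by (auto simp: term'_def L_def fun_eq_iff algebra_simps)
    finally show ?thesis unfolding G_def by (rule infsumI)
  qed
  have "G holomorphic_on S"
  proof -
    have "\<exists>d>0. G holomorphic_on ball z d" if "z \<in> S" for z
    proof -
      \<comment> \<open>The components of \<open>\<rho> d\<close> bound the moduli of the components
        of \<open>L w\<close> for all \<open>w\<close> within \<open>d\<close> of \<open>z\<close>.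
        As \<open>norm (\<rho> 0) = norm (L z) < r\<close>, some positive \<open>d\<close> keeps the
        real point \<open>c + \<rho> d\<close> in the ball; the given series converges absolutely
        there and supplies the Weierstrass majorant \<open>M\<close>.\<close>
      define \<rho> :: "real \<Rightarrow> real ^ 'n" where
        "\<rho> d = (\<chi> i. cmod (L z $ i) + d * \<bar>x $ i - p $ i\<bar>)" for d
      have "continuous_on UNIV (\<lambda>d. norm (\<rho> d))"
        unfolding \<rho>_def by (intro continuous_intros)
      then have "open {d. norm (\<rho> d) < r}"
        by (rule open_Collect_less) (rule continuous_on_const)
      moreover have "norm (\<rho> 0) < r"
        using that by (simp add: \<rho>_def S_def norm_vec_def)
      ultimately obtain d0 where d0: "d0 > 0" "ball 0 d0 \<subseteq> {d. norm (\<rho> d) < r}"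
        by (auto elim!: openE)
      define d where "d = d0 / 2"
      have d: "d > 0" "norm (\<rho> d) < r" using d0 by (auto simp: d_def subset_iff)
      define M where "M \<alpha> = norm (a \<alpha> * (\<Prod>i\<in>UNIV. (\<rho> d $ i) ^ \<alpha> i))" for \<alpha>
      have "M summable_on UNIV"
      proof -
        have "c + \<rho> d \<in> ball c r" using d by (simp add: dist_norm)
        from F[OF this] have "(\<lambda>\<alpha>. a \<alpha> * (\<Prod>i\<in>UNIV. (\<rho> d $ i) ^ \<alpha> i)) summable_on UNIV"
          by (auto simp: summable_on_def)
        then show ?thesis
          unfolding M_def by (rule summable_on_iff_abs_summable_on_real[THEN iffD1])
      qed
      moreover have "norm (term' w \<alpha>) \<le> M \<alpha>" if w: "w \<in> cball z d" for w \<alpha>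
      proof -
        have "cmod (L w $ i) \<le> \<rho> d $ i" for i
        proof -
          have "L w $ i = L z $ i + (w - z) * of_real (x $ i - p $ i)"
            by (simp add: L_def algebra_simps)
          also have "cmod \<dots> \<le> cmod (L z $ i) + cmod (w - z) * \<bar>x $ i - p $ i\<bar>"
            using norm_triangle_ineq[of "L z $ i" "(w - z) * of_real (x $ i - p $ i)"]
            by (simp add: norm_mult del: of_real_diff)
          also have "\<dots> \<le> \<rho> d $ i"
            using w by (auto simp: \<rho>_def dist_norm norm_minus_commute intro!: mult_right_mono)
          finally show ?thesis .
        qed
        then have "(\<Prod>i\<in>UNIV. cmod (L w $ i) ^ \<alpha> i) \<le> (\<Prod>i\<in>UNIV. (\<rho> d $ i) ^ \<alpha> i)"
          by (intro prod_mono conjI power_mono) auto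
        moreover have "0 \<le> (\<Prod>i\<in>UNIV. (\<rho> d $ i) ^ \<alpha> i)"
          using d by (auto intro!: prod_nonneg simp: \<rho>_def)
        ultimately show ?thesis
          by (simp add: term'_def M_def norm_mult norm_power abs_mult mult_left_mono flip: prod_norm)
      qed
      ultimately have unif: "uniform_limit (cball z d) (\<lambda>A w. \<Sum>\<alpha>\<in>A. term' w \<alpha>) G (finite_subsets_at_top UNIV)"
        using Weierstrass_m_test_general[of UNIV "cball z d" "\<lambda>\<alpha> w. term' w \<alpha>" M] by (simp add: G_def[abs_def])
      have hol: "(\<lambda>w. \<Sum>\<alpha>\<in>A. term' w \<alpha>) holomorphic_on B" for A B
        unfolding term'_def L_def by (auto intro!: holomorphic_intros)
      have "G holomorphic_on ball z d"
        by (rule holomorphic_uniform_limit[OF _ unif])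
          (auto intro!: hol holomorphic_on_imp_continuous_on)
      with d show ?thesis by blast
    qed
    then have "\<forall>z\<in>S. G field_differentiable at z"
      by (meson centre_in_ball holomorphic_on_imp_differentiable_at open_ball)
    then show ?thesis
      unfolding holomorphic_on_def by (blast intro: field_differentiable_at_within)
  qed
  have in_S: "0 \<in> S" "1 \<in> S" using real_line[of 0] real_line[of 1] p x by auto
  \<comment> \<open>Real parameters at which the line runs inside \<open>ball p e\<close>, so that
    \<open>G\<close> vanishes. They accumulate at 0, which forces \<open>G\<close> to vanish on
    \<open>S\<close>, in particular at 1, the parameter of \<open>x\<close>.\<close>
  define U where "U = S \<inter> of_real ` {t. t *\<^sub>R (x - p) \<in> ball 0 e}"
  have "G 1 = 0"
  proof (rule analytic_continuation[OF \<open>G holomorphic_on S\<close> \<open>open S\<close> \<open>connected S\<close>, of U 0])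
    show "U \<subseteq> S" by (auto simp: U_def)
    show "0 islimpt U"
      unfolding islimpt_approachable
    proof (intro allI impI)
      fix s :: real assume "s > 0"
      obtain s' where s': "s' > 0" "ball 0 s' \<subseteq> S"
        using \<open>open S\<close> in_S open_contains_ball by blast
      \<comment> \<open>The summand 1 keeps the denominator positive when
        \<open>x = p\<close>.\<close>
      define q where "q = e / (norm (x - p) + 1)"
      have "q > 0" using \<open>e > 0\<close> by (simp add: q_def add_nonneg_pos)
      define t where "t = min (min s s') q / 2"
      have "t > 0" "t < s" "t < s'" "t < q"
        using \<open>s > 0\<close> s' \<open>q > 0\<close> unfolding t_def by (auto simp: min_def)
      then have t: "t > 0" "t < s" "t < s'" "t < e / (norm (x - p) + 1)"
        by (simp_all add: q_def)
      have "t * norm (x - p) \<le> t * (norm (x - p) + 1)" using t by simp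
      also have "\<dots> < e" using t(4) by (simp add: pos_less_divide_eq add_nonneg_pos)
      finally have "of_real t \<in> U"
        using s' t by (auto simp: U_def dist_norm)
      then show "\<exists>x'\<in>U. x' \<noteq> 0 \<and> dist x' 0 < s"
        using t by (intro bexI[of _ "of_real t"]) auto
    qed
    fix z assume "z \<in> U"
    then obtain t where t: "z = of_real t" "of_real t \<in> S" "t *\<^sub>R (x - p) \<in> ball 0 e"
      by (auto simp: U_def)
    then show "G z = 0"
      using G_real[of t] zero[of "p + t *\<^sub>R (x - p)"] real_line by (auto simp: dist_norm)
  qed (use in_S in auto)
  then show ?thesis using G_real[of 1] in_S by simp
qed

text \<open>A connectedness argument for the set \<open>Z\<close> of points near which
  \<open>F\<close> vanishes. Each point of \<open>S\<close> has a ball that is either disjoint from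
  \<open>Z\<close> or contained in it, by the result on a single ball; this one dichotomy
  (\<open>step\<close>) makes both \<open>Z\<close> and \<open>S - Z\<close> open in
  \<open>S\<close>.\<close>

lemma real_analytic_on_eq_zero:
  fixes F :: "real ^ 'n \<Rightarrow> real"
  assumes an: "real_analytic_on F S" and "open S" "connected S"
    and "p \<in> S" "e > 0" and zero: "\<And>x. x \<in> S \<Longrightarrow> x \<in> ball p e \<Longrightarrow> F x = 0"
    and "x \<in> S"
  shows "F x = 0"
proof -
  define Z where "Z = {q \<in> S. \<exists>e>0. \<forall>x\<in>S. x \<in> ball q e \<longrightarrow> F x = 0}"
  have step: "\<exists>r>0. S \<inter> ball c r \<inter> Z \<noteq> {} \<longrightarrow> S \<inter> ball c r \<subseteq> Z" if "c \<in> S" for c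
  proof -
    obtain r a where r: "r > 0" and a: "\<And>x. x \<in> ball c r \<Longrightarrow>
        ((\<lambda>\<alpha>. a \<alpha> * (\<Prod>i\<in>UNIV. (x $ i - c $ i) ^ \<alpha> i)) has_sum F x) UNIV"
      using an \<open>c \<in> S\<close> unfolding real_analytic_on_def by blast
    obtain s where s: "s > 0" "ball c s \<subseteq> S" using \<open>open S\<close> \<open>c \<in> S\<close> open_contains_ball by blast
    have "S \<inter> ball c (min r s) \<subseteq> Z" if q: "q \<in> S \<inter> ball c (min r s) \<inter> Z" for q
    proof -
      obtain e where e: "e > 0" "\<forall>x\<in>S. x \<in> ball q e \<longrightarrow> F x = 0" using q by (auto simp: Z_def)
      have z: "F y = 0" if "y \<in> ball c (min r s)" for y
        by (rule power_series_eq_zero_on_ball[of c "min r s" a F q e]) (use a q e s that in auto)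
      show ?thesis
      proof
        fix y assume y: "y \<in> S \<inter> ball c (min r s)"
        then obtain e' where e': "e' > 0" "ball y e' \<subseteq> ball c (min r s)"
          using openE[OF open_ball, of y c "min r s"] by blast
        have "\<forall>w\<in>S. w \<in> ball y e' \<longrightarrow> F w = 0"
          using z e'(2) by (meson subsetD)
        then show "y \<in> Z"
          using y e'(1) unfolding Z_def by blast
      qed
    qed
    then show ?thesis using r s by (intro exI[of _ "min r s"] conjI impI) (simp, blast)
  qed
  have "Z \<subseteq> S" unfolding Z_def by (rule Collect_restrict)
  have "openin (top_of_set S) Z"
    unfolding openin_contains_ball
  proof (intro conjI ballI \<open>Z \<subseteq> S\<close>)
    fix c assume c: "c \<in> Z"
    then obtain r where "r > 0" "S \<inter> ball c r \<inter> Z \<noteq> {} \<longrightarrow> S \<inter> ball c r \<subseteq> Z"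
      using step[OF subsetD[OF \<open>Z \<subseteq> S\<close> c]] by auto
    then show "\<exists>e>0. ball c e \<inter> S \<subseteq> Z"
      using c \<open>Z \<subseteq> S\<close> by (intro exI[of _ r]) auto
  qed
  moreover have "openin (top_of_set S) (S - Z)"
    unfolding openin_contains_ball
  proof (intro conjI ballI Diff_subset)
    fix c assume c: "c \<in> S - Z"
    then obtain r where "r > 0" "S \<inter> ball c r \<inter> Z \<noteq> {} \<longrightarrow> S \<inter> ball c r \<subseteq> Z"
      using step[of c] by auto
    then show "\<exists>e>0. ball c e \<inter> S \<subseteq> S - Z"
      using c by (intro exI[of _ r]) auto
  qed
  then have "closedin (top_of_set S) Z"
    unfolding closedin_def using \<open>Z \<subseteq> S\<close> by simp
  ultimately have "Z = {} \<or> Z = S"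
    using connected_clopen[THEN iffD1, OF \<open>connected S\<close>, rule_format, of Z] by simp
  moreover have "p \<in> Z"
    unfolding Z_def using \<open>p \<in> S\<close> \<open>e > 0\<close> zero by (intro CollectI conjI exI[of _ e]) simp_all
  ultimately have "x \<in> Z" using \<open>x \<in> S\<close> by blast
  then obtain e' where "e' > 0" "\<forall>w\<in>S. w \<in> ball x e' \<longrightarrow> F w = 0"
    unfolding Z_def by blast
  then show ?thesis using \<open>x \<in> S\<close> centre_in_ball by blast
qed

section \<open>Absolutely continuous functions\<close>

text \<open>The fundamental theorem in gauge form, with integrability of \<open>y'\<close> part of
  the conclusion. Subintervals tagged off \<open>N\<close> are handled by differentiability; those
  tagged in \<open>N\<close> are forced into an open set of small measure, where absolute continuity
  bounds the sum of the increments.\<close>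

lemma abs_continuous_on_has_integral:
  fixes y :: "real \<Rightarrow> 'a::banach"
  assumes "a \<le> b" and ac: "abs_continuous_on a b y" and N: "negligible N"
    and der: "\<And>t. t \<in> {a..b} - N \<Longrightarrow> (y has_vector_derivative y' t) (at t within {a..b})"
  shows "(y' has_integral y b - y a) {a..b}"
proof -
  \<comment> \<open>With value 0 on \<open>N\<close>, a subinterval tagged there contributes nothing
    but the increment of \<open>y\<close>.\<close>
  define d where "d t = (if t \<in> N then 0 else y' t)" for t
  have "(d has_integral y b - y a) {a..b}"
    unfolding has_integral_real
  proof (intro allI impI)
    fix e :: real assume "e > 0"
    \<comment> \<open>Half of the error, spread over the length of the interval; the summand 1
      covers \<open>a = b\<close>.\<close>
    define e1 where "e1 = e / (2 * (b - a + 1))"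
    have "e1 > 0" using \<open>e > 0\<close> \<open>a \<le> b\<close> by (simp add: e1_def)
    obtain \<delta> where "\<delta> > 0" and \<delta>: "\<And>D. D division_of \<Union>D \<Longrightarrow> \<Union>D \<subseteq> {a..b} \<Longrightarrow>
        (\<Sum>K\<in>D. Sup K - Inf K) < \<delta> \<Longrightarrow> (\<Sum>K\<in>D. norm (y (Sup K) - y (Inf K))) < e / 2"
      using ac \<open>e > 0\<close> unfolding abs_continuous_on_def by (meson half_gt_zero)
    obtain T where T: "open T" "N \<subseteq> T" "T - N \<in> lmeasurable" "emeasure lebesgue (T - N) < ennreal \<delta>"
      using sets_lebesgue_outer_open[of N \<delta>] N \<open>\<delta> > 0\<close> negligible_imp_sets by blast
    have Tm: "T \<in> lmeasurable" "measure lebesgue T < \<delta>"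
    proof -
      have null: "N \<in> null_sets lebesgue" using N negligible_iff_null_sets by blast
      have sT: "T \<in> sets lebesgue" using \<open>open T\<close> by (simp add: borel_open sets_completionI_sets)
      then have "emeasure lebesgue T = emeasure lebesgue (T - N)"
        using null by (simp add: emeasure_Diff_null_set)
      then have less: "emeasure lebesgue T < ennreal \<delta>"
        using T(4) by simp
      then show lm: "T \<in> lmeasurable"
        using sT by (auto simp: fmeasurable_def intro: order.strict_trans)
      show "measure lebesgue T < \<delta>"
        using less \<open>\<delta> > 0\<close> by (simp add: emeasure_eq_measure2[OF lm] ennreal_less_iff)
    qed
    have "\<exists>r>0. t \<in> {a..b} - N \<longrightarrow>
         (\<forall>s\<in>{a..b}. norm (s-t) < r \<longrightarrow> norm (y s - y t - (s-t) *\<^sub>R y' t) \<le> e1 * norm (s-t))" for t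
      using der[of t] \<open>e1 > 0\<close> unfolding has_vector_derivative_def has_derivative_within_alt
      by (cases "t \<in> {a..b} - N") (blast, use zero_less_one in blast)
    then obtain r where r: "\<And>t. 0 < r t"
      "\<And>t s. t \<in> {a..b} - N \<Longrightarrow> s \<in> {a..b} \<Longrightarrow> norm (s-t) < r t \<Longrightarrow>
         norm (y s - y t - (s-t) *\<^sub>R y' t) \<le> e1 * norm (s-t)"
      by metis
    define \<gamma> where "\<gamma> t = (if t \<in> N then T else ball t (r t))" for t
    have g1: "gauge \<gamma>"
      using T r(1) by (auto simp: gauge_def \<gamma>_def)
    have g2: "norm ((\<Sum>(x,K)\<in>p. measure lborel K *\<^sub>R d x) - (y b - y a)) < e"
      if p: "p tagged_division_of {a..b}" and fine: "\<gamma> fine p" for p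
    proof -
      note pD = tagged_division_ofD[OF p]
      define P where "P = {z \<in> p. fst z \<in> N}"
      have "finite p" using pD by auto
      have P: "P \<subseteq> p" "finite P" unfolding P_def using \<open>finite p\<close> by auto
      define F where "F = (\<lambda>(x,K). measure lborel K *\<^sub>R d x - (y (Sup K) - y (Inf K)))"
      have K: "\<exists>u v. K = {u..v} \<and> u \<le> v \<and> u \<in> {a..b} \<and> v \<in> {a..b} \<and> x \<in> {u..v}" if "(x,K) \<in> p" for x K
      proof -
        obtain u v where "K = cbox u v" using pD(4)[OF \<open>(x,K) \<in> p\<close>] by auto
        moreover have "x \<in> K" "K \<subseteq> {a..b}" using pD that by blast+
        ultimately show ?thesis by (intro exI[of _ u] exI[of _ v]) auto
      qed
      have "(\<Sum>(x,K)\<in>p. measure lborel K *\<^sub>R d x) - (y b - y a) = sum F p"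
        using additive_tagged_division_1[OF \<open>a \<le> b\<close> p, of y]
        by (simp add: F_def split_def sum_subtractf)
      also have "\<dots> = sum F (p - P) + sum F P"
        using P \<open>finite p\<close> by (simp add: sum.subset_diff)
      finally have eq: "(\<Sum>(x,K)\<in>p. measure lborel K *\<^sub>R d x) - (y b - y a) = sum F (p - P) + sum F P" .
      have len: "(\<Sum>(x,K)\<in>p. Sup K - Inf K) = b - a"
        using additive_tagged_division_1[OF \<open>a \<le> b\<close> p, of "\<lambda>x. x"] by simp
      have "norm (sum F (p - P)) \<le> (\<Sum>(x,K)\<in>p - P. e1 * (Sup K - Inf K))"
      proof (rule sum_norm_le)
        fix z assume "z \<in> p - P"
        then obtain x K where z: "z = (x,K)" and xK: "(x,K) \<in> p" "(x,K) \<notin> P"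
          by (metis Diff_iff surj_pair)
        then have "x \<notin> N" by (auto simp: P_def)
        obtain u v where uv: "K = {u..v}" "u \<le> v" "u \<in> {a..b}" "v \<in> {a..b}" "x \<in> {u..v}"
          using K xK by blast
        have "K \<subseteq> ball x (r x)" using fine xK \<open>x \<notin> N\<close> by (fastforce simp: fine_def \<gamma>_def)
        moreover have "u \<in> K" "v \<in> K" using uv by auto
        ultimately have "u \<in> ball x (r x)" "v \<in> ball x (r x)" by blast+
        then have near: "norm (u - x) < r x" "norm (v - x) < r x"
          by (auto simp: dist_real_def)
        have xin: "x \<in> {a..b} - N" using uv \<open>x \<notin> N\<close> by auto
        \<comment> \<open>Both endpoints are expanded at the tag, where \<open>y x\<close> cancels.
          As \<open>u \<le> x \<le> v\<close>, the two errors add up to exactly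
          \<open>e1 * (v - u)\<close>.\<close>
        have "F (x,K) = (y u - y x - (u - x) *\<^sub>R y' x) - (y v - y x - (v - x) *\<^sub>R y' x)"
          using uv \<open>x \<notin> N\<close> by (simp add: F_def d_def algebra_simps)
        also have "norm \<dots> \<le> norm (y u - y x - (u - x) *\<^sub>R y' x) + norm (y v - y x - (v - x) *\<^sub>R y' x)"
          by (rule norm_triangle_ineq4)
        also have "\<dots> \<le> e1 * norm (u - x) + e1 * norm (v - x)"
          by (intro add_mono r(2)[OF xin] near uv)
        also have "\<dots> = e1 * (v - u)" using uv by (simp add: algebra_simps)
        finally show "norm (F z) \<le> (case z of (x,K) \<Rightarrow> e1 * (Sup K - Inf K))"
          using uv z by simp
      qed
      also have "\<dots> \<le> (\<Sum>(x,K)\<in>p. e1 * (Sup K - Inf K))"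
      proof (rule sum_mono2)
        fix z assume "z \<in> p - (p - P)"
        then show "0 \<le> (case z of (x,K) \<Rightarrow> e1 * (Sup K - Inf K))"
          using K[of "fst z" "snd z"] \<open>e1 > 0\<close> by (auto simp: split_def)
      qed (use \<open>finite p\<close> in auto)
      also have "\<dots> = e1 * (b - a)"
        using len by (simp add: split_def flip: sum_distrib_left)
      also have "\<dots> \<le> e / 2"
        using \<open>a \<le> b\<close> \<open>e > 0\<close> unfolding e1_def by (simp add: field_simps)
      finally have 1: "norm (sum F (p - P)) \<le> e / 2" .
      have P': "P tagged_partial_division_of {a..b}"
        using tagged_partial_division_subset[OF _ P(1)] p by (auto simp: tagged_division_of_def)
      then have P'': "P tagged_division_of \<Union>(snd ` P)"
        by (rule tagged_partial_division_of_Union_self)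
      define D where "D = snd ` P"
      have D: "D division_of \<Union>D"
        using division_of_tagged_division[OF P''] by (simp add: D_def)
      have Dsub: "\<Union>D \<subseteq> {a..b}"
        unfolding D_def using pD(3) P(1) by (intro Union_least) fastforce
      have DT: "\<Union>D \<subseteq> T"
        using fine by (fastforce simp: D_def P_def fine_def \<gamma>_def)
      have DK: "\<exists>u v. K = {u..v} \<and> u \<le> v" if "K \<in> D" for K
        using that K P(1) unfolding D_def by force
      have "(\<Sum>K\<in>D. Sup K - Inf K) = (\<Sum>K\<in>D. measure lborel K)"
        by (rule sum.cong) (use DK in force)+
      also have "\<dots> = measure lebesgue (\<Union>D)"
      proof -
        have "(\<Sum>K\<in>D. measure lborel K) = (\<Sum>K\<in>D. measure lebesgue K)"
          by (rule sum.cong) (use DK in fastforce)+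
        then show ?thesis using content_division[OF D] by simp
      qed
      also have "\<dots> \<le> measure lebesgue T"
        using DT Tm(1) D by (meson fmeasurableD lmeasurable_division measure_mono_fmeasurable)
      also have "\<dots> < \<delta>" by fact
      finally have small: "(\<Sum>K\<in>D. norm (y (Sup K) - y (Inf K))) < e / 2"
        using \<delta>[OF D Dsub] by blast
      \<comment> \<open>Passing from tagged pairs to the set \<open>D\<close> could merge pairs with
        the same interval, but only degenerate intervals can carry two tags, and their increment is
        0. The library rule also asks for value 0 at the empty set, where \<open>Sup\<close> and
        \<open>Inf\<close> give nothing usable.\<close>
      define G where "G K = (if K = {} then 0 else norm (y (Sup K) - y (Inf K)))" for K
      have "(\<Sum>(x,K)\<in>P. norm (y (Sup K) - y (Inf K))) = (\<Sum>(x,K)\<in>P. G K)"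
        by (rule sum.cong) (use P pD(2) in \<open>force simp: G_def\<close>)+
      also have "\<dots> = (\<Sum>K\<in>D. G K)"
        unfolding D_def
      proof (rule sum.over_tagged_division_lemma[OF P''])
        fix u v :: real assume "box u v = {}"
        then show "G (cbox u v) = 0"
          by (cases "u = v") (auto simp: G_def)
      qed
      also have "\<dots> = (\<Sum>K\<in>D. norm (y (Sup K) - y (Inf K)))"
        by (rule sum.cong) (use DK in \<open>force simp: G_def\<close>)+
      finally have "(\<Sum>(x,K)\<in>P. norm (y (Sup K) - y (Inf K))) = (\<Sum>K\<in>D. norm (y (Sup K) - y (Inf K)))" .
      moreover have "norm (sum F P) \<le> (\<Sum>(x,K)\<in>P. norm (y (Sup K) - y (Inf K)))"
        by (rule sum_norm_le) (auto simp: F_def P_def d_def norm_minus_commute)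
      ultimately have "norm (sum F P) < e / 2" using small by simp
      then show ?thesis
        unfolding eq using 1 norm_triangle_ineq[of "sum F (p - P)" "sum F P"] by linarith
    qed
    show "\<exists>\<gamma>. gauge \<gamma> \<and> (\<forall>\<D>. \<D> tagged_division_of {a..b} \<and> \<gamma> fine \<D> \<longrightarrow>
        norm ((\<Sum>(x,K)\<in>\<D>. measure lborel K *\<^sub>R d x) - (y b - y a)) < e)"
      by (intro exI[of _ \<gamma>] conjI allI impI g1, elim conjE, rule g2)
  qed
  then show ?thesis
    by (rule has_integral_spike[OF N, rotated]) (simp add: d_def)
qed

text \<open>Used for \<open>v\<close> along a trajectory, \<open>v\<close> being Lipschitz on a
  ball, and, with the identity as \<open>y\<close>, for Lipschitz curves.\<close>

lemma abs_continuous_on_dominated: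
  assumes ac: "abs_continuous_on a b y" and "L \<ge> 0"
    and le: "\<And>s t. s \<in> {a..b} \<Longrightarrow> t \<in> {a..b} \<Longrightarrow> norm (\<phi> s - \<phi> t) \<le> L * norm (y s - y t)"
  shows "abs_continuous_on a b \<phi>"
  unfolding abs_continuous_on_def
proof (intro allI impI)
  fix e :: real assume "e > 0"
  \<comment> \<open>\<open>L + 1\<close> instead of \<open>L\<close> avoids division by zero and
    makes the final inequality strict.\<close>
  have "e / (L + 1) > 0" using \<open>e > 0\<close> \<open>L \<ge> 0\<close> by simp
  then obtain \<delta> where "\<delta> > 0" and \<delta>: "\<And>D. D division_of \<Union>D \<Longrightarrow> \<Union>D \<subseteq> {a..b} \<Longrightarrow>
      (\<Sum>K\<in>D. Sup K - Inf K) < \<delta> \<Longrightarrow> (\<Sum>K\<in>D. norm (y (Sup K) - y (Inf K))) < e / (L + 1)"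
    using ac unfolding abs_continuous_on_def by meson
  have "(\<Sum>K\<in>D. norm (\<phi> (Sup K) - \<phi> (Inf K))) < e"
    if D: "D division_of \<Union>D" "\<Union>D \<subseteq> {a..b}" "(\<Sum>K\<in>D. Sup K - Inf K) < \<delta>" for D
  proof -
    have "norm (\<phi> (Sup K) - \<phi> (Inf K)) \<le> L * norm (y (Sup K) - y (Inf K))" if "K \<in> D" for K
    proof -
      obtain u v where "K = cbox u v" "K \<noteq> {}" using division_ofD(3,4)[OF D(1) \<open>K \<in> D\<close>] by blast
      moreover have "K \<subseteq> {a..b}" using D(2) \<open>K \<in> D\<close> by blast
      ultimately show ?thesis by (intro le) auto
    qed
    then have "(\<Sum>K\<in>D. norm (\<phi> (Sup K) - \<phi> (Inf K))) \<le> L * (\<Sum>K\<in>D. norm (y (Sup K) - y (Inf K)))"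
      by (simp add: sum_distrib_left sum_mono)
    also have "\<dots> \<le> L * (e / (L + 1))"
      using \<delta>[OF D] \<open>L \<ge> 0\<close> by (intro mult_left_mono) auto
    also have "\<dots> < e"
      using \<open>L \<ge> 0\<close> \<open>e > 0\<close> by (simp add: field_simps)
    finally show ?thesis .
  qed
  then show "\<exists>\<delta>>0. \<forall>D. D division_of \<Union>D \<and> \<Union>D \<subseteq> {a..b} \<and> (\<Sum>K\<in>D. Sup K - Inf K) < \<delta>
        \<longrightarrow> (\<Sum>K\<in>D. norm (\<phi> (Sup K) - \<phi> (Inf K))) < e"
    using \<open>\<delta> > 0\<close> by (intro exI[of _ \<delta>]) simp
qed

lemma Lipschitz_imp_abs_continuous_on:
  fixes y :: "real \<Rightarrow> 'a::real_normed_vector"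
  assumes "L \<ge> 0" "\<And>s t. s \<in> {a..b} \<Longrightarrow> t \<in> {a..b} \<Longrightarrow> norm (y s - y t) \<le> L * \<bar>s - t\<bar>"
  shows "abs_continuous_on a b y"
proof (rule abs_continuous_on_dominated[of a b "\<lambda>t. t" L])
  show "abs_continuous_on a b (\<lambda>t. t)"
    unfolding abs_continuous_on_def
  proof (intro allI impI)
    fix e :: real assume "e > 0"
    have "(\<Sum>K\<in>D. norm (Sup K - Inf K)) < e"
      if D: "D division_of \<Union>D" "(\<Sum>K\<in>D. Sup K - Inf K) < e" for D :: "real set set"
    proof -
      have "norm (Sup K - Inf K) = Sup K - Inf K" if "K \<in> D" for K
      proof -
        obtain u v where "K = cbox u v" "K \<noteq> {}" using division_ofD(3,4)[OF D(1) \<open>K \<in> D\<close>] by blast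
        then show ?thesis by auto
      qed
      then show ?thesis using D(2) by simp
    qed
    then show "\<exists>\<delta>>0. \<forall>D. D division_of \<Union>D \<and> \<Union>D \<subseteq> {a..b} \<and> (\<Sum>K\<in>D. Sup K - Inf K) < \<delta>
        \<longrightarrow> (\<Sum>K\<in>D. norm (Sup K - Inf K)) < e"
      using \<open>e > 0\<close> by (intro exI[of _ e]) simp
  qed
qed (use assms in auto)

lemma abs_continuous_on_imp_continuous_on:
  assumes ac: "abs_continuous_on a b y"
  shows "continuous_on {a..b} y"
  unfolding continuous_on_iff
proof (intro ballI allI impI)
  fix s and e :: real assume s: "s \<in> {a..b}" and "e > 0"
  then obtain \<delta> where "\<delta> > 0" and \<delta>: "\<And>D. D division_of \<Union>D \<Longrightarrow> \<Union>D \<subseteq> {a..b} \<Longrightarrow>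
      (\<Sum>K\<in>D. Sup K - Inf K) < \<delta> \<Longrightarrow> (\<Sum>K\<in>D. norm (y (Sup K) - y (Inf K))) < e"
    using ac unfolding abs_continuous_on_def by meson
  have le: "norm (y v - y u) < e" if "u \<le> v" "v - u < \<delta>" "u \<in> {a..b}" "v \<in> {a..b}" for u v
    using \<delta>[of "{{u..v}}"] division_of_self[of u v] that by auto
  have "dist (y t) (y s) < e" if "t \<in> {a..b}" "dist t s < \<delta>" for t
    using le[of s t] le[of t s] that s by (cases "s \<le> t") (auto simp: dist_norm norm_minus_commute)
  then show "\<exists>d>0. \<forall>t\<in>{a..b}. dist t s < d \<longrightarrow> dist (y t) (y s) < e"
    using \<open>\<delta> > 0\<close> by blast
qed

lemma abs_continuous_on_subset:
  assumes "abs_continuous_on a b y" "a \<le> c" "d \<le> b"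
  shows "abs_continuous_on c d y"
proof -
  have "{c..d} \<subseteq> {a..b}" using assms by auto
  then show ?thesis
    using assms(1) unfolding abs_continuous_on_def by (meson order_trans)
qed

section \<open>C1 maps, almost-everywhere bounds and a Gronwall lemma\<close>

lemma C1_on_imp_continuous_on:
  assumes "C1_on F S"
  shows "continuous_on S F"
  using assms unfolding C1_on_def
  by (meson continuous_at_imp_continuous_on has_derivative_continuous)

lemma C1_on_imp_Lipschitz:
  fixes F :: "'a::real_normed_vector \<Rightarrow> 'b::real_normed_vector"
  assumes "C1_on F S" "compact K" "convex K" "K \<subseteq> S"
  obtains L where "L \<ge> 0" "\<And>x y. x \<in> K \<Longrightarrow> y \<in> K \<Longrightarrow> norm (F x - F y) \<le> L * norm (x - y)"
proof -
  obtain D where D: "\<And>x. x \<in> S \<Longrightarrow> (F has_derivative blinfun_apply (D x)) (at x)"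
    and cont: "continuous_on S D"
    using assms(1) unfolding C1_on_def by blast
  have "compact (D ` K)"
    using cont assms by (meson compact_continuous_image continuous_on_subset)
  then obtain L where L: "L > 0" "\<And>x. x \<in> K \<Longrightarrow> norm (D x) \<le> L"
    using compact_imp_bounded bounded_pos by (metis imageI)
  have "norm (F x - F y) \<le> L * norm (x - y)" if "x \<in> K" "y \<in> K" for x y
    by (rule differentiable_bound[OF \<open>convex K\<close>, of F "\<lambda>x. blinfun_apply (D x)"])
      (use that D L assms(4) in \<open>auto intro: has_derivative_at_withinI simp flip: norm_blinfun.rep_eq\<close>)
  then show thesis using that[of L] L by auto
qed

lemma bounded_bilinear_matrix_vector_mult:
  "bounded_bilinear (\<lambda>(A :: real ^ 'm ^ 'n) x. A *v x)"
  unfolding bilinear_conv_bounded_bilinear[symmetric] bilinear_def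
  by (auto intro!: linearI simp: matrix_vector_mult_add_rdistrib matrix_vector_right_distrib
      matrix_vector_mult_scaleR scaleR_matrix_vector_assoc)

lemma AE_lebesgue_on_negligibleE:
  assumes "AE t in lebesgue_on A. P t" "A \<in> sets lebesgue"
  obtains N where "negligible N" "\<And>t. t \<in> A - N \<Longrightarrow> P t"
proof -
  have "AE t in lebesgue. t \<in> A \<longrightarrow> P t"
    using assms by (simp add: AE_restrict_space_iff)
  then have "negligible {t. \<not> (t \<in> A \<longrightarrow> P t)}"
    by (simp add: completion.AE_iff_null_sets negligible_iff_null_sets)
  then show thesis by (rule that) auto
qed

lemma has_integral_norm_le_ae:
  fixes d :: "real \<Rightarrow> 'a::banach"
  assumes "(d has_integral I) S" "(k has_integral J) S" "negligible N"
    and "\<And>t. t \<in> S - N \<Longrightarrow> norm (d t) \<le> k t"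
  shows "norm I \<le> J"
proof -
  have "((\<lambda>t. if t \<in> N then 0 else d t) has_integral I) S"
    by (rule has_integral_spike[OF assms(3) _ assms(1)]) auto
  moreover have "((\<lambda>t. if t \<in> N then 0 else k t) has_integral J) S"
    by (rule has_integral_spike[OF assms(3) _ assms(2)]) auto
  ultimately show ?thesis
    using integral_norm_bound_integral[of "\<lambda>t. if t \<in> N then 0 else d t" S "\<lambda>t. if t \<in> N then 0 else k t"] assms(4)
    by (auto simp: has_integral_iff)
qed

text \<open>The primitive of \<open>w\<close>, multiplied by \<open>exp (- K * t)\<close>, is
  nonincreasing and starts at 0; being nonnegative, it vanishes at \<open>b\<close>, and the bound
  at \<open>b\<close> gives the claim.\<close>

lemma Gronwall_zero:
  fixes w :: "real \<Rightarrow> real"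
  assumes "0 \<le> b" and cont: "continuous_on {0..b} w"
    and le: "\<And>t. t \<in> {0..b} \<Longrightarrow> 0 \<le> w t \<and> w t \<le> K * integral {0..t} w"
  shows "w b = 0"
proof -
  define G where "G t = integral {0..t} w" for t
  define E where "E t = exp (- K * t) * G t" for t
  have G: "(G has_vector_derivative w t) (at t within {0..b})" if "t \<in> {0..b}" for t
    unfolding G_def using integral_has_vector_derivative[OF cont that] .
  then have contG: "continuous_on {0..b} G"
    by (meson continuous_on_eq_continuous_within has_vector_derivative_continuous)
  have "E b \<le> E 0"
  proof (rule DERIV_nonpos_imp_decreasing_open[OF \<open>0 \<le> b\<close>])
    fix t assume t: "0 < t" "t < b"
    then have "(G has_real_derivative w t) (at t)"
      using G[of t] by (simp add: at_within_Icc_at has_real_derivative_iff_has_vector_derivative)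
    then have "(E has_real_derivative exp (- K * t) * (w t - K * G t)) (at t)"
      unfolding E_def by (auto intro!: derivative_eq_intros simp: algebra_simps)
    moreover have "exp (- K * t) * (w t - K * G t) \<le> 0"
      using le[of t] t by (simp add: G_def mult_le_0_iff)
    ultimately show "\<exists>y. (E has_real_derivative y) (at t) \<and> y \<le> 0" by blast
  qed (auto simp: E_def intro!: continuous_intros contG)
  then have "G b \<le> 0" by (simp add: E_def G_def mult_le_0_iff)
  moreover have "0 \<le> G b"
    unfolding G_def by (intro integral_nonneg integrable_continuous_real cont) (use le in auto)
  ultimately show ?thesis using le[of b] \<open>0 \<le> b\<close> by (auto simp: G_def)
qed

section \<open>Peano's existence theorem\<close>

text \<open>Negative times are included on purpose: \<open>{0..t}\<close> is then empty and the
  primitive is 0. This provides the constant history that the delayed equation looks back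
  on.\<close>

lemma integral_primitive_Lipschitz:
  fixes G :: "real \<Rightarrow> 'a::banach"
  assumes cont: "continuous_on UNIV G" and bound: "\<And>s. norm (G s) \<le> B"
  shows "norm (integral {0..t} G - integral {0..s} G) \<le> B * \<bar>t - s\<bar>"
proof -
  have *: "norm (integral {0..t} G - integral {0..s} G) \<le> B * (t - s)" if "s \<le> t" for s t
  proof -
    define s' t' where "s' = max 0 s" and "t' = max 0 t"
    have st: "0 \<le> s'" "s' \<le> t'" "t' - s' \<le> t - s" using that by (auto simp: s'_def t'_def)
    have B: "B \<ge> 0" using bound[of 0] norm_ge_zero order_trans by blast
    have neg: "integral {0..q} G = integral {0..max 0 q} G" for q :: real
      by (cases "q < 0") (auto simp: max_def)
    have "G integrable_on {0..t'}"
      using cont by (auto intro!: integrable_continuous_real intro: continuous_on_subset)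
    from Henstock_Kurzweil_Integration.integral_combine[OF st(1,2) this]
    have "integral {0..s'} G + integral {s'..t'} G = integral {0..t'} G" .
    then have "integral {0..t} G - integral {0..s} G = integral {s'..t'} G"
      using neg[of s] neg[of t] by (simp add: s'_def t'_def algebra_simps)
    also have "norm \<dots> \<le> B * (t' - s')"
      using st cont bound by (intro integral_bound) (auto intro: continuous_on_subset)
    also have "\<dots> \<le> B * (t - s)" using st B by (intro mult_left_mono) auto
    finally show ?thesis .
  qed
  show ?thesis
    using *[of s t] *[of t s] by (cases "s \<le> t") (auto simp: norm_minus_commute)
qed

text \<open>The delay makes the equation explicit, since values up to time \<open>t\<close> depend
  only on values up to \<open>t - \<delta>\<close>. Picard iterates therefore become stationary on
  bounded intervals after finitely many steps, and continuity of \<open>F\<close> suffices.\<close>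

lemma delayed_integral_equation:
  fixes F :: "'a::banach \<Rightarrow> 'a"
  assumes cont: "continuous_on UNIV F" and bound: "\<And>p. norm (F p) \<le> B" and "\<delta> > 0"
  obtains z where "z 0 = x" "\<And>s t. norm (z s - z t) \<le> B * \<bar>s - t\<bar>"
    "\<And>t. t \<le> b \<Longrightarrow> z t = x + integral {0..t} (\<lambda>s. F (z (s - \<delta>)))"
proof -
  define P where "P z t = x + integral {0..t} (\<lambda>s. F (z (s - \<delta>)))" for z :: "real \<Rightarrow> 'a" and t
  define Y where "Y j = (P ^^ j) (\<lambda>_. x)" for j
  have Y_Suc: "Y (Suc j) = P (Y j)" for j by (simp add: Y_def)
  have B: "B \<ge> 0" using bound[of x] norm_ge_zero order_trans by blast
  have Lip: "norm (Y j s - Y j t) \<le> B * \<bar>s - t\<bar>" for j s t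
  proof (induction j arbitrary: s t)
    case 0
    then show ?case using B by (simp add: Y_def)
  next
    case (Suc j)
    have contY: "continuous_on UNIV (Y j)"
      by (rule lipschitz_on_continuous_on[of B], rule lipschitz_onI) (auto simp: dist_norm Suc B)
    have "continuous_on UNIV (\<lambda>s. F (Y j (s - \<delta>)))"
      by (rule continuous_on_compose2[OF cont continuous_on_compose2[OF contY]])
        (auto intro!: continuous_intros)
    from integral_primitive_Lipschitz[OF this bound, of s t] show ?case
      by (simp add: Y_Suc P_def)
  qed
  \<comment> \<open>Each iteration settles one more stretch of length \<open>\<delta>\<close>; for
    \<open>j = 0\<close> only nonpositive times are claimed, where both sides are
    \<open>x\<close>.\<close>
  have stable: "Y (Suc j) t = Y j t" if "t \<le> real j * \<delta>" for j t
    using that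
  proof (induction j arbitrary: t)
    case 0
    then show ?case by (cases "t = 0") (auto simp: Y_def P_def)
  next
    case (Suc j)
    have "Y (Suc j) (s - \<delta>) = Y j (s - \<delta>)" if "s \<in> {0..t}" for s
      using that Suc.prems by (intro Suc.IH) (auto simp: algebra_simps)
    then show ?case
      unfolding Y_Suc[of "Suc j"] Y_Suc[of j] P_def
      by (intro arg_cong[of _ _ "(+) x"] integral_cong) (simp add: Y_Suc P_def)
  qed
  \<comment> \<open>For times up to \<open>b\<close> the delayed arguments lie where the iterates
    \<open>j\<close> and \<open>Suc j\<close> already agree, so iterate \<open>Suc j\<close>
    satisfies its own equation.\<close>
  obtain j where j: "b < real j * \<delta>" using reals_Archimedean3[OF \<open>\<delta> > 0\<close>] by blast
  show thesis
  proof (rule that[of "Y (Suc j)"])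
    show "Y (Suc j) 0 = x" by (simp add: Y_Suc P_def)
    show "norm (Y (Suc j) s - Y (Suc j) t) \<le> B * \<bar>s - t\<bar>" for s t by (rule Lip)
    fix t assume "t \<le> b"
    then have "Y j (s - \<delta>) = Y (Suc j) (s - \<delta>)" if "s \<in> {0..t}" for s
      using that j \<open>\<delta> > 0\<close> by (intro stable[symmetric]) auto
    then show "Y (Suc j) t = x + integral {0..t} (\<lambda>s. F (Y (Suc j) (s - \<delta>)))"
      by (subst Y_Suc) (auto simp: P_def intro!: integral_cong)
  qed
qed

text \<open>Tonelli's scheme: approximations with delay \<open>1 / Suc n\<close> share the Lipschitz
  constant \<open>B\<close>, so a subsequence converging at the rationals converges everywhere, and
  dominated convergence yields the integral equation. The derivative is claimed only for
  \<open>t > 0\<close>, because \<open>y\<close> is constant for negative times and may have a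
  corner at 0.\<close>

lemma Peano_existence:
  fixes F :: "'a::euclidean_space \<Rightarrow> 'a"
  assumes cont: "continuous_on UNIV F" and bound: "\<And>p. norm (F p) \<le> B"
  obtains y where "y 0 = x" "\<And>s t. norm (y s - y t) \<le> B * \<bar>s - t\<bar>"
    "\<And>t. t > 0 \<Longrightarrow> (y has_vector_derivative F (y t)) (at t)"
proof -
  have B: "B \<ge> 0" using bound[of x] norm_ge_zero order_trans by blast
  have "\<exists>z. z 0 = x \<and> (\<forall>s t. norm (z s - z t) \<le> B * \<bar>s - t\<bar>) \<and>
      (\<forall>t\<le>real n. z t = x + integral {0..t} (\<lambda>s. F (z (s - 1 / real (Suc n)))))" for n
    by (rule delayed_integral_equation[OF cont bound, of "1 / real (Suc n)" x "real n"])
      (simp, blast)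
  then obtain Z where Z0: "\<And>n. Z n 0 = x"
    and Lip: "\<And>n s t. norm (Z n s - Z n t) \<le> B * \<bar>s - t\<bar>"
    and eq: "\<And>n t. t \<le> real n \<Longrightarrow> Z n t = x + integral {0..t} (\<lambda>s. F (Z n (s - 1 / real (Suc n))))"
    by metis
  obtain k where k: "strict_mono k"
    and conv: "\<And>q. q \<in> \<rat> \<Longrightarrow> \<exists>l. (\<lambda>n. (Z (k n) q - x) /\<^sub>R (1 + \<bar>q\<bar>)) \<longlonglongrightarrow> l"
  \<comment> \<open>The selection theorem wants one bound for all rationals, whereas
    \<open>Z n q - x\<close> may grow linearly in \<open>q\<close>; dividing by
    \<open>1 + \<bar>q\<bar>\<close> restores the bound \<open>B\<close> and is undone in
    \<open>convQ\<close>.\<close>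
  proof (rule function_convergent_subsequence[of "\<rat>" "\<lambda>n q. (Z n q - x) /\<^sub>R (1 + \<bar>q\<bar>)" B])
    fix n and q :: real
    have "norm (Z n q - x) \<le> B * \<bar>q\<bar>" using Lip[of n q 0] Z0 by simp
    also have "\<dots> \<le> B * (1 + \<bar>q\<bar>)" using B by (intro mult_left_mono) auto
    finally show "norm ((Z n q - x) /\<^sub>R (1 + \<bar>q\<bar>)) \<le> B"
      by (simp add: divide_inverse_commute[symmetric] pos_divide_le_eq)
  qed (auto simp: countable_rat)
  have convQ: "convergent (\<lambda>n. Z (k n) q)" if q: "q \<in> \<rat>" for q
  proof -
    obtain l where "(\<lambda>n. (Z (k n) q - x) /\<^sub>R (1 + \<bar>q\<bar>)) \<longlonglongrightarrow> l" using conv[OF q] by blast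
    then have "(\<lambda>n. x + (1 + \<bar>q\<bar>) *\<^sub>R ((Z (k n) q - x) /\<^sub>R (1 + \<bar>q\<bar>))) \<longlonglongrightarrow> x + (1 + \<bar>q\<bar>) *\<^sub>R l"
      by (intro tendsto_intros)
    then show ?thesis by (auto simp: convergent_def)
  qed
  have "convergent (\<lambda>n. Z (k n) t)" for t
  proof -
    have "Cauchy (\<lambda>n. Z (k n) t)"
      unfolding Cauchy_iff
    proof (intro allI impI)
      fix e :: real assume "e > 0"
      have "0 < e / (3 * (B + 1))" using B \<open>e > 0\<close> by simp
      then obtain q where q: "q \<in> \<rat>" "\<bar>t - q\<bar> < e / (3 * (B + 1))"
        using Rats_dense_in_real[of "t - e / (3 * (B + 1))" t] by (auto simp: abs_if)
      have "B * \<bar>t - q\<bar> \<le> B * (e / (3 * (B + 1)))"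
        using q B by (intro mult_left_mono) auto
      also have "\<dots> < e / 3" using B \<open>e > 0\<close> by (simp add: field_simps)
      finally have small: "B * \<bar>t - q\<bar> < e / 3" .
      have "Cauchy (\<lambda>n. Z (k n) q)" using convQ[OF q(1)] convergent_Cauchy by blast
      then obtain M where M: "\<And>m n. m \<ge> M \<Longrightarrow> n \<ge> M \<Longrightarrow> norm (Z (k m) q - Z (k n) q) < e / 3"
        using \<open>e > 0\<close> unfolding Cauchy_iff by (meson divide_pos_pos zero_less_numeral)
      have "norm (Z (k m) t - Z (k n) t) < e" if "m \<ge> M" "n \<ge> M" for m n
      proof -
        have "Z (k m) t - Z (k n) t
            = (Z (k m) t - Z (k m) q) + (Z (k m) q - Z (k n) q) - (Z (k n) t - Z (k n) q)" by simp
        also have "norm \<dots> \<le> norm (Z (k m) t - Z (k m) q) + norm (Z (k m) q - Z (k n) q)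
            + norm (Z (k n) t - Z (k n) q)"
          by (meson norm_triangle_ineq norm_triangle_ineq4 add_right_mono order_trans)
        also have "\<dots> < e"
          using Lip[of "k m" t q] Lip[of "k n" t q] M[OF that] small by linarith
        finally show ?thesis .
      qed
      then show "\<exists>M. \<forall>m\<ge>M. \<forall>n\<ge>M. norm (Z (k m) t - Z (k n) t) < e" by blast
    qed
    then show ?thesis by (rule Cauchy_convergent)
  qed
  then obtain y where y: "\<And>t. (\<lambda>n. Z (k n) t) \<longlonglongrightarrow> y t"
    unfolding convergent_def by metis
  have y0: "y 0 = x"
    using y[of 0] by (simp add: Z0 LIMSEQ_const_iff)
  have y_Lip: "norm (y s - y t) \<le> B * \<bar>s - t\<bar>" for s t
    by (rule tendsto_upperbound[OF tendsto_norm[OF tendsto_diff[OF y y]]]) (auto simp: Lip)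
  have cont_y: "continuous_on UNIV y"
    by (rule lipschitz_on_continuous_on[of B], rule lipschitz_onI) (auto simp: dist_norm y_Lip B)
  have delay: "(\<lambda>n. 1 / real (Suc (k n))) \<longlonglongrightarrow> 0"
    using LIMSEQ_subseq_LIMSEQ[OF LIMSEQ_inverse_real_of_nat k] by (simp add: o_def inverse_eq_divide)
  have int: "y t = x + integral {0..t} (\<lambda>s. F (y s))" for t
  proof -
    \<comment> \<open>The delayed argument differs from \<open>s\<close> by
      \<open>1 / Suc (k n)\<close>, which moves the value of \<open>Z (k n)\<close> by at most
      \<open>B\<close> times as much.\<close>
    have lim: "(\<lambda>n. F (Z (k n) (s - 1 / real (Suc (k n))))) \<longlonglongrightarrow> F (y s)" for s
    proof -
      have "(\<lambda>n. Z (k n) (s - 1 / real (Suc (k n))) - Z (k n) s) \<longlonglongrightarrow> 0"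
      proof (rule Lim_null_comparison[of _ "\<lambda>n. B * (1 / real (Suc (k n)))"])
        show "\<forall>\<^sub>F n in sequentially. norm (Z (k n) (s - 1 / real (Suc (k n))) - Z (k n) s)
            \<le> B * (1 / real (Suc (k n)))"
        proof (intro always_eventually allI)
          fix n
          show "norm (Z (k n) (s - 1 / real (Suc (k n))) - Z (k n) s) \<le> B * (1 / real (Suc (k n)))"
            using Lip[of "k n" "s - 1 / real (Suc (k n))" s] by simp
        qed
        show "(\<lambda>n. B * (1 / real (Suc (k n)))) \<longlonglongrightarrow> 0"
          using tendsto_mult_left[OF delay, of B] by simp
      qed
      from tendsto_add[OF this y[of s]] have "(\<lambda>n. Z (k n) (s - 1 / real (Suc (k n)))) \<longlonglongrightarrow> y s"
        by simp
      then show ?thesis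
        by (intro continuous_on_tendsto_compose[OF cont]) auto
    qed
    have contZ: "continuous_on UNIV (Z n)" for n
      by (rule lipschitz_on_continuous_on[of B], rule lipschitz_onI) (auto simp: dist_norm Lip B)
    have intg: "(\<lambda>s. F (Z (k n) (s - 1 / real (Suc (k n))))) integrable_on {0..t}" for n
      by (rule integrable_continuous_real,
          rule continuous_on_compose2[OF cont continuous_on_compose2[OF contZ]])
        (auto intro!: continuous_intros)
    have "(\<lambda>n. integral {0..t} (\<lambda>s. F (Z (k n) (s - 1 / real (Suc (k n)))))) \<longlonglongrightarrow> integral {0..t} (\<lambda>s. F (y s))"
      by (rule dominated_convergence(2)[OF intg, of "\<lambda>_. B"]) (rule integrable_const_ivl bound lim)+
    then have 1: "(\<lambda>n. x + integral {0..t} (\<lambda>s. F (Z (k n) (s - 1 / real (Suc (k n)))))) \<longlonglongrightarrow>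
        x + integral {0..t} (\<lambda>s. F (y s))"
      by (intro tendsto_intros)
    \<comment> \<open>The delayed equation for \<open>Z (k n)\<close> is known only up to time
      \<open>k n\<close>, which is at least \<open>t\<close> once \<open>n \<ge> m\<close>.\<close>
    obtain m where "t \<le> real m" using real_arch_simple by blast
    have "\<forall>\<^sub>F n in sequentially. x + integral {0..t} (\<lambda>s. F (Z (k n) (s - 1 / real (Suc (k n))))) = Z (k n) t"
    proof (rule eventually_sequentiallyI[of m])
      fix n assume "m \<le> n"
      then have "real m \<le> real (k n)" using seq_suble[OF k, of n] by simp
      then show "x + integral {0..t} (\<lambda>s. F (Z (k n) (s - 1 / real (Suc (k n))))) = Z (k n) t"
        using eq[of t "k n"] \<open>t \<le> real m\<close> by simp
    qed
    from Lim_transform_eventually[OF 1 this] show ?thesis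
      using y[of t] LIMSEQ_unique by blast
  qed
  show thesis
  proof (rule that[of y])
    fix t :: real assume "t > 0"
    have "continuous_on {0..t + 1} (\<lambda>s. F (y s))"
      by (rule continuous_on_compose2[OF cont continuous_on_subset[OF cont_y]]) auto
    from integral_has_vector_derivative[OF this, of t]
    have "((\<lambda>t. x + integral {0..t} (\<lambda>s. F (y s))) has_vector_derivative F (y t)) (at t within {0..t + 1})"
      using \<open>t > 0\<close> by (auto intro!: derivative_eq_intros)
    then show "(y has_vector_derivative F (y t)) (at t)"
      using \<open>t > 0\<close> unfolding int[symmetric] by (simp add: at_within_Icc_at)
  qed (use y0 y_Lip in auto)
qed

section \<open>Caratheodory solutions and their cost\<close>

lemma time_interval_lebesgue: "{t. 0 \<le> t \<and> ereal t < T} \<in> sets lebesgue"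
proof (cases T)
  case (real r)
  then have "{t. 0 \<le> t \<and> ereal t < T} = {0..<r}" by auto
  then show ?thesis by simp
next
  case PInf
  then have "{t. 0 \<le> t \<and> ereal t < T} = {0..}" by auto
  then show ?thesis by simp
qed auto

lemma carath_solution_derivative:
  assumes "carath_solution f g u x T y"
  obtains N where "negligible N"
    "\<And>t. 0 \<le> t \<Longrightarrow> ereal t < T \<Longrightarrow> t \<notin> N \<Longrightarrow> (y has_vector_derivative f (y t) + g (y t) *v u t) (at t)"
proof -
  have "AE t in lebesgue_on {t. 0 \<le> t \<and> ereal t < T}.
      (y has_vector_derivative f (y t) + g (y t) *v u t) (at t)"
    using assms by (simp add: carath_solution_def)
  from AE_lebesgue_on_negligibleE[OF this time_interval_lebesgue] show thesis
    using that by (metis (mono_tags, lifting) DiffI mem_Collect_eq)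
qed

lemma carath_solution_abs_continuous:
  assumes "carath_solution f g u x T y" "0 \<le> a" "ereal b < T"
  shows "abs_continuous_on a b y"
proof (cases "0 \<le> b")
  case True
  then have "abs_continuous_on 0 b y" using assms by (simp add: carath_solution_def)
  then show ?thesis using assms(2) by (rule abs_continuous_on_subset) simp
next
  case False
  then show ?thesis
    using assms(2) by (intro Lipschitz_imp_abs_continuous_on[of 0]) auto
qed

lemma carath_solution_has_integral:
  assumes "carath_solution f g u x T y" "0 \<le> a" "a \<le> b" "ereal b < T"
  shows "((\<lambda>t. f (y t) + g (y t) *v u t) has_integral y b - y a) {a..b}"
proof -
  obtain N where N: "negligible N"
    "\<And>t. 0 \<le> t \<Longrightarrow> ereal t < T \<Longrightarrow> t \<notin> N \<Longrightarrow> (y has_vector_derivative f (y t) + g (y t) *v u t) (at t)"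
    using carath_solution_derivative[OF assms(1)] by blast
  show ?thesis
  proof (rule abs_continuous_on_has_integral[OF assms(3) carath_solution_abs_continuous N(1)])
    fix t assume t: "t \<in> {a..b} - N"
    then have "ereal t \<le> ereal b" by simp
    then have "ereal t < T" using assms(4) by (rule le_less_trans)
    then show "(y has_vector_derivative f (y t) + g (y t) *v u t) (at t within {a..b})"
      using t assms N(2) by (auto intro: has_vector_derivative_at_within)
  qed (use assms in auto)
qed

lemma admissible_controls_bounded:
  assumes "u \<in> admissible_controls"
  obtains C N where "C \<ge> 0" "negligible N" "\<And>t. t \<ge> 0 \<Longrightarrow> t \<notin> N \<Longrightarrow> norm (u t) \<le> C"
proof -
  obtain C where "AE t in lebesgue_on {0..}. norm (u t) \<le> C"
    using assms by (auto simp: admissible_controls_def)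
  then obtain N where N: "negligible N" "\<And>t. t \<in> {0..} - N \<Longrightarrow> norm (u t) \<le> C"
    by (rule AE_lebesgue_on_negligibleE) auto
  show thesis
  proof (rule that[of "max C 0" N])
    show "norm (u t) \<le> max C 0" if "t \<ge> 0" "t \<notin> N" for t
      using N(2)[of t] that by auto
  qed (use N in auto)
qed

text \<open>Up to time \<open>b\<close> both curves stay in one closed ball, on which
  \<open>f\<close> and \<open>g\<close> are Lipschitz. Since \<open>u\<close> is essentially bounded
  by \<open>C\<close>, the right-hand side is Lipschitz in the state with constant \<open>K\<close>
  for almost every time, and Gronwall applies to the distance.\<close>

lemma carath_solution_unique:
  fixes f :: "real ^ 'n \<Rightarrow> real ^ 'n" and g :: "real ^ 'n \<Rightarrow> real ^ 'm ^ 'n"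
  assumes f_C1: "C1_on f UNIV" and g_C1: "C1_on g UNIV" and u: "u \<in> admissible_controls"
    and y: "carath_solution f g u x T y" and z: "carath_solution f g u x T' z"
    and "0 \<le> b" "ereal b < T" "ereal b < T'"
  shows "y b = z b"
proof -
  have bt: "ereal t < T" "ereal t < T'" if "t \<in> {0..b}" for t
    using that assms(7,8) by (auto intro: le_less_trans[of _ "ereal b"])
  have conty: "continuous_on {0..b} y" and contz: "continuous_on {0..b} z"
    using carath_solution_abs_continuous[OF y] carath_solution_abs_continuous[OF z] assms
    by (auto intro!: abs_continuous_on_imp_continuous_on)
  have "compact (y ` {0..b} \<union> z ` {0..b})"
    using conty contz by (intro compact_Un compact_continuous_image) auto
  then obtain r where "\<forall>p\<in>y ` {0..b} \<union> z ` {0..b}. norm p \<le> r"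
    using compact_imp_bounded[THEN bounded_iff[THEN iffD1]] by blast
  then have r: "\<And>t. t \<in> {0..b} \<Longrightarrow> y t \<in> cball 0 r \<and> z t \<in> cball 0 r"
    by simp
  obtain Lf where Lf: "Lf \<ge> 0" "\<And>p q. p \<in> cball 0 r \<Longrightarrow> q \<in> cball 0 r \<Longrightarrow> norm (f p - f q) \<le> Lf * norm (p - q)"
    using C1_on_imp_Lipschitz[OF f_C1, of "cball 0 r"] by auto
  obtain Lg where Lg: "Lg \<ge> 0" "\<And>p q. p \<in> cball 0 r \<Longrightarrow> q \<in> cball 0 r \<Longrightarrow> norm (g p - g q) \<le> Lg * norm (p - q)"
    using C1_on_imp_Lipschitz[OF g_C1, of "cball 0 r"] by auto
  obtain B where B: "B > 0" "\<And>(A :: real ^ 'm ^ 'n) w. norm (A *v w) \<le> norm A * norm w * B"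
    using bounded_bilinear.pos_bounded[OF bounded_bilinear_matrix_vector_mult] by blast
  obtain C N where C: "C \<ge> 0" "negligible N" "\<And>t. t \<ge> 0 \<Longrightarrow> t \<notin> N \<Longrightarrow> norm (u t) \<le> C"
    using admissible_controls_bounded[OF u] by blast
  define K where "K = Lf + Lg * C * B"
  define w where "w t = norm (y t - z t)" for t
  have "w b = 0"
  proof (rule Gronwall_zero[of b w K])
    show cw: "continuous_on {0..b} w"
      unfolding w_def by (intro continuous_intros conty contz)
    fix c assume c: "c \<in> {0..b}"
    have "((\<lambda>t. (f (y t) + g (y t) *v u t) - (f (z t) + g (z t) *v u t)) has_integral
        (y c - y 0) - (z c - z 0)) {0..c}"
      using c bt by (intro has_integral_diff carath_solution_has_integral[OF y] carath_solution_has_integral[OF z]) auto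
    moreover have "y 0 = z 0" using y z by (simp add: carath_solution_def)
    ultimately have 1: "((\<lambda>t. (f (y t) + g (y t) *v u t) - (f (z t) + g (z t) *v u t)) has_integral y c - z c) {0..c}"
      by simp
    have "w integrable_on {0..c}"
      using c by (intro integrable_continuous_real continuous_on_subset[OF cw]) auto
    then have 2: "((\<lambda>t. K * w t) has_integral K * integral {0..c} w) {0..c}"
      by (intro has_integral_mult_right integrable_integral)
    have "norm (y c - z c) \<le> K * integral {0..c} w"
    proof (rule has_integral_norm_le_ae[OF 1 2 C(2)])
      fix t assume t: "t \<in> {0..c} - N"
      then have rt: "y t \<in> cball 0 r" "z t \<in> cball 0 r" using r c by auto
      have "norm ((f (y t) + g (y t) *v u t) - (f (z t) + g (z t) *v u t))
          = norm ((f (y t) - f (z t)) + (g (y t) - g (z t)) *v u t)"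
        by (simp add: matrix_vector_mult_diff_rdistrib algebra_simps)
      also have "\<dots> \<le> norm (f (y t) - f (z t)) + norm ((g (y t) - g (z t)) *v u t)"
        by (rule norm_triangle_ineq)
      also have "\<dots> \<le> Lf * w t + (Lg * w t) * C * B"
      proof (rule add_mono)
        show "norm (f (y t) - f (z t)) \<le> Lf * w t" using Lf rt by (simp add: w_def)
        have "norm ((g (y t) - g (z t)) *v u t) \<le> norm (g (y t) - g (z t)) * norm (u t) * B"
          by (rule B)
        also have "\<dots> \<le> (Lg * w t) * C * B"
          using Lg rt B C t by (intro mult_mono) (auto simp: w_def)
        finally show "norm ((g (y t) - g (z t)) *v u t) \<le> (Lg * w t) * C * B" .
      qed
      also have "\<dots> = K * w t" by (simp add: K_def algebra_simps)
      finally show "norm ((f (y t) + g (y t) *v u t) - (f (z t) + g (z t) *v u t)) \<le> K * w t" .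
    qed
    then show "0 \<le> w c \<and> w c \<le> K * integral {0..c} w" by (simp add: w_def)
  qed fact
  then show ?thesis by (simp add: w_def)
qed

lemma carath_solution_imp_maximal:
  "carath_solution f g u x \<infinity> y \<Longrightarrow> maximal_solution f g u x \<infinity> y"
  by (simp add: maximal_solution_def)

text \<open>\<open>trajectory\<close> is an arbitrary choice with its own lifetime \<open>T\<close>.
  If \<open>T\<close> were finite, the global solution \<open>y\<close>, equal to it before
  \<open>T\<close> by uniqueness, would extend it and contradict maximality.\<close>

lemma trajectory_eq:
  assumes "C1_on f UNIV" "C1_on g UNIV" "u \<in> admissible_controls"
    and y: "carath_solution f g u x \<infinity> y" and "t \<ge> 0"
  shows "trajectory f g u x t = y t"
proof -
  obtain T where T: "maximal_solution f g u x T (trajectory f g u x)"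
    unfolding trajectory_def using someI_ex[of "\<lambda>y. \<exists>T. maximal_solution f g u x T y"]
      carath_solution_imp_maximal[OF y] by blast
  then have c: "carath_solution f g u x T (trajectory f g u x)"
    by (simp add: maximal_solution_def)
  have eq: "y t = trajectory f g u x t" if "0 \<le> t" "ereal t < T" for t
    using carath_solution_unique[OF assms(1-3) y c] that by simp
  have "T = \<infinity>"
  proof (rule ccontr)
    assume "T \<noteq> \<infinity>"
    then have "T < \<infinity>" by simp
    then show False using T y eq unfolding maximal_solution_def by blast
  qed
  then show ?thesis using eq[of t] \<open>t \<ge> 0\<close> by simp
qed

lemma cost_eq:
  assumes "C1_on f UNIV" "C1_on g UNIV" "u \<in> admissible_controls"
    and y: "carath_solution f g u x \<infinity> y"
  shows "cost f g h R x u = (\<integral>\<^sup>+ t. ennreal (h (y t) + u t \<bullet> (R *v u t)) \<partial>lebesgue_on {0..})"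
proof -
  have "\<exists>y. maximal_solution f g u x \<infinity> y"
    using carath_solution_imp_maximal[OF y] by blast
  then show ?thesis
    unfolding cost_def using trajectory_eq[OF assms] by (auto intro!: nn_integral_cong)
qed

lemma cost_eq_infinity:
  assumes "\<nexists>y. carath_solution f g u x \<infinity> y"
  shows "cost f g h R x u = \<infinity>"
  using assms by (auto simp: cost_def maximal_solution_def)

section \<open>Bounds for integrals and hitting times\<close>

lemma nn_integral_lebesgue_on_mono:
  assumes "A \<subseteq> B" "A \<in> sets lebesgue" "B \<in> sets lebesgue"
  shows "(\<integral>\<^sup>+ t. F t \<partial>lebesgue_on A) \<le> (\<integral>\<^sup>+ t. F t \<partial>lebesgue_on B)"
proof -
  have "(\<integral>\<^sup>+ t. F t * indicator A t \<partial>lebesgue) \<le> (\<integral>\<^sup>+ t. F t * indicator B t \<partial>lebesgue)"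
    using assms(1) by (intro nn_integral_mono) (auto split: split_indicator)
  then show ?thesis using assms by (simp add: nn_integral_restrict_space)
qed

text \<open>The bridge from gauge integrals of derivatives, which may change sign, to the
  \<open>ennreal\<close> cost. An infinite right-hand side leaves nothing to show; a finite one
  makes \<open>k\<close> gauge integrable too.\<close>

lemma has_integral_le_nn_integral:
  fixes d k :: "real \<Rightarrow> real"
  assumes d: "(d has_integral I) S" and S: "S \<in> sets lebesgue" and N: "negligible N"
    and le: "\<And>t. t \<in> S - N \<Longrightarrow> d t \<le> k t"
    and k: "k \<in> borel_measurable (lebesgue_on S)" "\<And>t. t \<in> S \<Longrightarrow> 0 \<le> k t"
  shows "ennreal I \<le> (\<integral>\<^sup>+ t. ennreal (k t) \<partial>lebesgue_on S)"
proof (cases "(\<integral>\<^sup>+ t. ennreal (k t) \<partial>lebesgue_on S) < \<infinity>")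
  case True
  have nonneg: "AE t in lebesgue_on S. 0 \<le> k t"
    by (rule AE_I2) (use k S in auto)
  have int: "integrable (lebesgue_on S) k"
    by (rule integrableI_nonneg[OF k(1) nonneg True])
  define J where "J = integral\<^sup>L (lebesgue_on S) k"
  have "(k has_integral J) S"
    unfolding J_def by (rule has_integral_integral_lebesgue_on[OF int S])
  then have J: "((\<lambda>t. if t \<in> N then 0 else k t) has_integral J) S"
    by (rule has_integral_spike[OF N, rotated]) auto
  have "((\<lambda>t. if t \<in> N then 0 else d t) has_integral I) S"
    by (rule has_integral_spike[OF N _ d]) auto
  from has_integral_le[OF this J] have "I \<le> J" using le by auto
  then show ?thesis
    unfolding nn_integral_eq_integral[OF int nonneg] J_def by (rule ennreal_leI)
next
  case False
  then show ?thesis by (simp add: less_top[symmetric])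
qed

text \<open>Projecting on the direction \<open>sgn I\<close> of the total displacement reduces to
  the scalar case, since \<open>sgn I \<bullet> I = norm I\<close>.\<close>

lemma norm_has_integral_le_nn_integral:
  fixes d :: "real \<Rightarrow> 'a::euclidean_space"
  assumes d: "(d has_integral I) S" and S: "S \<in> sets lebesgue" and N: "negligible N"
    and le: "\<And>t. t \<in> S - N \<Longrightarrow> norm (d t) \<le> k t"
    and k: "k \<in> borel_measurable (lebesgue_on S)" "\<And>t. t \<in> S \<Longrightarrow> 0 \<le> k t"
  shows "ennreal (norm I) \<le> (\<integral>\<^sup>+ t. ennreal (k t) \<partial>lebesgue_on S)"
proof -
  have "((\<lambda>t. sgn I \<bullet> d t) has_integral sgn I \<bullet> I) S"
    using has_integral_linear[OF d bounded_linear_inner_right[of "sgn I"]] by (simp add: o_def)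
  moreover have "sgn I \<bullet> I = norm I"
    by (cases "I = 0") (simp_all add: sgn_div_norm dot_square_norm power2_eq_square)
  moreover have "sgn I \<bullet> d t \<le> k t" if "t \<in> S - N" for t
  proof -
    have "sgn I \<bullet> d t \<le> norm (sgn I) * norm (d t)" by (rule norm_cauchy_schwarz)
    also have "\<dots> \<le> 1 * norm (d t)" by (intro mult_right_mono) (auto simp: norm_sgn)
    finally show ?thesis using le[OF that] by simp
  qed
  ultimately show ?thesis
    using has_integral_le_nn_integral[OF _ S N _ k, of "\<lambda>t. sgn I \<bullet> d t" "norm I"] by simp
qed

lemma nn_integral_half_line_le:
  fixes k :: "real \<Rightarrow> real"
  assumes k: "\<And>t. t \<ge> 0 \<Longrightarrow> 0 \<le> k t"
    and int: "\<And>n::nat. (k has_integral I n) {0..real n}" and le: "\<And>n. I n \<le> c"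
  shows "(\<integral>\<^sup>+ t. ennreal (k t) \<partial>lebesgue_on {0..}) \<le> ennreal c"
proof -
  define F where "F n t = ennreal (k t) * indicator {0..real n} t" for n t
  have F: "F n \<in> borel_measurable lebesgue" "integral\<^sup>N lebesgue (F n) = ennreal (I n)" for n
  proof -
    have "(\<lambda>t. k t * indicator {0..real n} t) \<in> borel_measurable lebesgue"
      using has_integral_implies_lebesgue_measurable[OF int[of n]] by (simp add: mult.commute)
    then have "(\<lambda>t. ennreal (k t * indicator {0..real n} t)) \<in> borel_measurable lebesgue"
      by simp
    also have "(\<lambda>t. ennreal (k t * indicator {0..real n} t)) = F n"
      by (auto simp: F_def split: split_indicator)
    finally show "F n \<in> borel_measurable lebesgue" .
    show "integral\<^sup>N lebesgue (F n) = ennreal (I n)"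
      unfolding F_def nn_integral_completion
      by (rule nn_integral_has_integral_lebesgue'[OF _ int]) (use k in auto)
  qed
  have "(\<integral>\<^sup>+ t. ennreal (k t) \<partial>lebesgue_on {0..}) = (\<integral>\<^sup>+ t. ennreal (k t) * indicator {0..} t \<partial>lebesgue)"
    by (simp add: nn_integral_restrict_space)
  also have "\<dots> = (\<integral>\<^sup>+ t. (SUP n. F n t) \<partial>lebesgue)"
  proof (rule nn_integral_cong)
    fix t :: real
    obtain m where m: "t \<le> real m" using real_arch_simple by blast
    show "ennreal (k t) * indicator {0..} t = (SUP n. F n t)"
    proof (rule antisym)
      have "ennreal (k t) * indicator {0..} t = F m t"
        using m by (auto simp: F_def split: split_indicator)
      also have "\<dots> \<le> (SUP n. F n t)" by (rule SUP_upper) simp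
      finally show "ennreal (k t) * indicator {0..} t \<le> (SUP n. F n t)" .
      show "(SUP n. F n t) \<le> ennreal (k t) * indicator {0..} t"
        by (rule SUP_least) (auto simp: F_def split: split_indicator)
    qed
  qed
  also have "\<dots> = (SUP n. integral\<^sup>N lebesgue (F n))"
  proof (rule nn_integral_monotone_convergence_SUP)
    show "incseq F"
      by (auto simp: incseq_def le_fun_def F_def split: split_indicator)
  qed (rule F)
  also have "\<dots> \<le> ennreal c"
    unfolding F(2) by (intro SUP_least ennreal_leI le)
  finally show ?thesis .
qed

lemma first_hitting_time:
  fixes q :: "real \<Rightarrow> real"
  assumes cont: "continuous_on {a..b} q" and "a \<le> b" "q a < \<beta>" "\<beta> \<le> q b"
  obtains \<tau> where "a < \<tau>" "\<tau> \<le> b" "q \<tau> = \<beta>" "\<And>s. a \<le> s \<Longrightarrow> s < \<tau> \<Longrightarrow> q s < \<beta>"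
proof -
  define S where "S = {t \<in> {a..b}. q t = \<beta>}"
  have ne: "S \<noteq> {}"
    using IVT'[of q a \<beta> b] assms by (auto simp: S_def)
  have "compact S"
  proof -
    have "closed S"
      unfolding S_def by (rule continuous_closed_preimage_constant[OF cont closed_atLeastAtMost])
    moreover have "bounded S"
      unfolding S_def by (rule bounded_subset[OF bounded_closed_interval[of a b] Collect_restrict])
    ultimately show ?thesis by (simp add: compact_eq_bounded_closed)
  qed
  from compact_attains_inf[OF this ne]
  obtain \<tau> where \<tau>: "\<tau> \<in> S" "\<And>t. t \<in> S \<Longrightarrow> \<tau> \<le> t"
    by blast
  have "q s < \<beta>" if s: "a \<le> s" "s < \<tau>" for s
  proof (rule ccontr)
    assume "\<not> q s < \<beta>"
    moreover have "s \<le> b" using s \<tau> by (auto simp: S_def)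
    ultimately obtain t where "a \<le> t" "t \<le> s" "q t = \<beta>"
      using IVT'[of q a \<beta> s] continuous_on_subset[OF cont, of "{a..s}"] assms s by auto
    then show False using \<tau>(2)[of t] s \<open>s \<le> b\<close> by (auto simp: S_def)
  qed
  moreover have "a < \<tau>" using \<tau>(1) assms(3) by (cases "a = \<tau>") (auto simp: S_def)
  ultimately show thesis using that[of \<tau>] \<tau>(1) by (auto simp: S_def)
qed

text \<open>\<open>t\<close> is the first time at level \<open>\<beta>\<close>, and \<open>s\<close>
  the last time before it at level \<open>\<alpha>\<close>; in between the path stays in the
  strip.\<close>

lemma crossing_interval:
  fixes q :: "real \<Rightarrow> real"
  assumes cont: "continuous_on {a..b} q" and "a \<le> b" "q a < \<alpha>" "\<alpha> < \<beta>" "\<beta> \<le> q b"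
  obtains s t where "a \<le> s" "s < t" "t \<le> b" "q s = \<alpha>" "q t = \<beta>"
    "\<And>r. s \<le> r \<Longrightarrow> r \<le> t \<Longrightarrow> \<alpha> \<le> q r \<and> q r \<le> \<beta>"
proof -
  obtain t where t: "a < t" "t \<le> b" "q t = \<beta>" "\<And>s. a \<le> s \<Longrightarrow> s < t \<Longrightarrow> q s < \<beta>"
    using first_hitting_time[OF cont, of \<beta>] assms by auto
  \<comment> \<open>Reversing time and sign turns the last visit to \<open>\<alpha>\<close> before
    \<open>t\<close> into a first hitting time.\<close>
  have "continuous_on {- t..- a} (\<lambda>s. - q (- s))"
    using t by (intro continuous_intros continuous_on_compose2[OF cont]) auto
  then obtain \<tau> where \<tau>: "- t < \<tau>" "\<tau> \<le> - a" "- q (- \<tau>) = - \<alpha>"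
    "\<And>s. - t \<le> s \<Longrightarrow> s < \<tau> \<Longrightarrow> - q (- s) < - \<alpha>"
    using first_hitting_time[of "- t" "- a" "\<lambda>s. - q (- s)" "- \<alpha>"] t assms by auto
  show thesis
  proof (rule that[of "- \<tau>" t])
    show "\<alpha> \<le> q r \<and> q r \<le> \<beta>" if "- \<tau> \<le> r" "r \<le> t" for r
    proof
      show "\<alpha> \<le> q r" using \<tau>(3) \<tau>(4)[of "- r"] that by (cases "r = - \<tau>") auto
      show "q r \<le> \<beta>" using t(3) t(4)[of r] that \<tau>(2) by (cases "r = t") auto
    qed
  qed (use \<tau> t in auto)
qed

section \<open>The Hamilton-Jacobi-Bellman equation\<close>

lemma sym_pos_def_coercive:
  fixes R :: "real ^ 'm ^ 'm"
  assumes "sym_pos_def R"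
  obtains c where "c > 0" "\<And>w. c * (norm w)\<^sup>2 \<le> w \<bullet> (R *v w)"
proof -
  have cont: "continuous_on (sphere 0 1) (\<lambda>w :: real ^ 'm. w \<bullet> (R *v w))"
    by (intro continuous_intros)
  have "sphere 0 1 \<noteq> ({} :: (real ^ 'm) set)" by simp
  from continuous_attains_inf[OF compact_sphere this cont] obtain w0 :: "real ^ 'm" where w0: "w0 \<in> sphere 0 1"
    "\<And>w. w \<in> sphere 0 1 \<Longrightarrow> w0 \<bullet> (R *v w0) \<le> w \<bullet> (R *v w)"
    by blast
  show thesis
  proof (rule that[of "w0 \<bullet> (R *v w0)"])
    show "0 < w0 \<bullet> (R *v w0)"
    proof -
      have "w0 \<noteq> 0" using w0(1) by auto
      then show ?thesis using assms by (simp add: sym_pos_def_def)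
    qed
    fix w
    show "(w0 \<bullet> (R *v w0)) * (norm w)\<^sup>2 \<le> w \<bullet> (R *v w)"
    proof (cases "w = 0")
      case False
      have "w = norm w *\<^sub>R sgn w" by (simp add: sgn_div_norm False)
      then have "w \<bullet> (R *v w) = (norm w *\<^sub>R sgn w) \<bullet> (R *v (norm w *\<^sub>R sgn w))" by simp
      also have "\<dots> = (norm w)\<^sup>2 * (sgn w \<bullet> (R *v sgn w))"
        by (simp add: matrix_vector_mult_scaleR power2_eq_square)
      also have "\<dots> \<ge> (norm w)\<^sup>2 * (w0 \<bullet> (R *v w0))"
        by (intro mult_left_mono w0(2)) (use False in \<open>auto simp: norm_sgn\<close>)
      finally show ?thesis by (simp add: mult.commute)
    qed simp
  qed
qed

text \<open>\<open>gradient\<close> is a definite description, so existence and uniqueness are both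
  due; the derivative \<open>F'\<close> is represented by \<open>adjoint F' 1\<close>.\<close>

lemma GDERIV_gradient:
  fixes F :: "'a::euclidean_space \<Rightarrow> real"
  assumes "F differentiable (at x)"
  shows "GDERIV F x :> gradient F x"
proof -
  obtain F' where F': "(F has_derivative F') (at x)" using assms by (auto simp: differentiable_def)
  then have lin: "linear F'" by (simp add: has_derivative_linear)
  have "F' = (\<lambda>w. w \<bullet> adjoint F' 1)"
    using adjoint_works[OF lin, of _ 1] by auto
  then have D: "GDERIV F x :> adjoint F' 1"
    using F' by (simp add: gderiv_def)
  moreover have "D' = adjoint F' 1" if "GDERIV F x :> D'" for D'
  proof -
    have "(\<lambda>w. w \<bullet> D') = (\<lambda>w. w \<bullet> adjoint F' 1)"
      using that D by (intro has_derivative_unique[of F]) (auto simp: gderiv_def)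
    then have "w \<bullet> D' = w \<bullet> adjoint F' 1" for w by (rule fun_cong)
    then show ?thesis by (intro vector_eq_rdot[THEN iffD1]) (simp add: inner_commute)
  qed
  ultimately show ?thesis unfolding gradient_def by (rule theI)
qed

lemma C1_on_imp_continuous_on_gradient:
  fixes F :: "'a::euclidean_space \<Rightarrow> real"
  assumes "C1_on F S"
  shows "continuous_on S (gradient F)"
proof -
  obtain D where D: "\<And>x. x \<in> S \<Longrightarrow> (F has_derivative blinfun_apply (D x)) (at x)"
    and cont: "continuous_on S D"
    using assms unfolding C1_on_def by blast
  have "gradient F x \<bullet> b = D x b" if "x \<in> S" for x b
  proof -
    have "GDERIV F x :> gradient F x"
      using D[OF that] by (intro GDERIV_gradient) (auto simp: differentiable_def)
    then have "(\<lambda>w. w \<bullet> gradient F x) = blinfun_apply (D x)"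
      using D[OF that] by (intro has_derivative_unique[of F]) (auto simp: gderiv_def)
    from fun_cong[OF this, of b] show ?thesis by (simp add: inner_commute)
  qed
  then have "continuous_on S (\<lambda>x. gradient F x \<bullet> b) \<longleftrightarrow> continuous_on S (\<lambda>x. D x b)" for b
    by (rule continuous_on_cong[OF refl])
  moreover have "continuous_on S (\<lambda>x. D x b)" for b
    by (intro blinfun.continuous_on cont continuous_on_const)
  ultimately show ?thesis
    unfolding continuous_on_componentwise[of S "gradient F"] by blast
qed

lemma sym_pos_def_matrix_inv:
  fixes R :: "real ^ 'm ^ 'm"
  assumes "sym_pos_def R"
  shows "R ** matrix_inv R = mat 1"
proof -
  have "\<forall>w. R *v w = 0 \<longrightarrow> w = 0"
    using assms unfolding sym_pos_def_def by (metis inner_zero_right less_irrefl)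
  then have "invertible R"
    using invertible_left_inverse matrix_left_invertible_ker by blast
  then show ?thesis unfolding invertible_def matrix_inv_def
    by (metis (mono_tags, lifting) someI_ex)
qed

lemma sym_pos_def_inner_commute:
  assumes "sym_pos_def R"
  shows "w \<bullet> (R *v z) = z \<bullet> (R *v w)"
proof -
  have "w \<bullet> (R *v z) = (transpose R *v w) \<bullet> z"
    by (simp add: dot_lmul_matrix)
  also have "transpose R = R" using assms by (simp add: sym_pos_def_def)
  finally show ?thesis by (simp add: inner_commute)
qed

lemma sym_pos_def_nonneg:
  assumes "sym_pos_def R"
  shows "0 \<le> w \<bullet> (R *v w)"
  using assms by (cases "w = 0") (auto simp: sym_pos_def_def intro: less_imp_le)

section \<open>The equation for \<open>v\<close> and its pointwise consequences\<close>

locale hjb_solution =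
  fixes f :: "real ^ 'n \<Rightarrow> real ^ 'n"
    and g :: "real ^ 'n \<Rightarrow> real ^ 'm ^ 'n"
    and h :: "real ^ 'n \<Rightarrow> real"
    and R :: "real ^ 'm ^ 'm"
    and \<Omega> :: "(real ^ 'n) set"
    and v :: "real ^ 'n \<Rightarrow> real"
  assumes f_C1: "C1_on f UNIV"
    and g_C1: "C1_on g UNIV"
    and h_C1: "C1_on h UNIV"
    and R_spd: "sym_pos_def R"
    and h_0: "h 0 = 0"
    and h_pos: "x \<noteq> 0 \<Longrightarrow> 0 < h x"
    and Omega: "open \<Omega>" "0 \<in> \<Omega>"
    and v_C1: "C1_on v \<Omega>"
    and v_nonneg: "x \<in> \<Omega> \<Longrightarrow> 0 \<le> v x"
    and v_0: "v 0 = 0"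
    and HJB: "x \<in> \<Omega> \<Longrightarrow>
      (f x + g x *v feedback g R v x) \<bullet> gradient v x + h x
        + (weighted_norm R (feedback g R v x))\<^sup>2 = 0"
begin

lemma h_nonneg: "0 \<le> h x"
  using h_pos[of x] h_0 by (cases "x = 0") auto

lemma continuous_f: "continuous_on S f"
  and continuous_g: "continuous_on S g"
  and continuous_h: "continuous_on S h"
  using C1_on_imp_continuous_on[OF f_C1] C1_on_imp_continuous_on[OF g_C1]
    C1_on_imp_continuous_on[OF h_C1] by (auto intro: continuous_on_subset)

lemma continuous_v: "continuous_on \<Omega> v"
  by (rule C1_on_imp_continuous_on[OF v_C1])

lemma GDERIV_v: "x \<in> \<Omega> \<Longrightarrow> GDERIV v x :> gradient v x"
  using v_C1 by (intro GDERIV_gradient) (auto simp: C1_on_def differentiable_def)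

lemma vector_derivative_v:
  assumes "y t \<in> \<Omega>" "(y has_vector_derivative w) (at t)"
  shows "((\<lambda>t. v (y t)) has_vector_derivative w \<bullet> gradient v (y t)) (at t)"
proof -
  have "(v has_derivative (\<lambda>w. w \<bullet> gradient v (y t))) (at (y t))"
    using GDERIV_v[OF assms(1)] by (simp add: gderiv_def)
  from vector_derivative_diff_chain_within[OF assms(2) has_derivative_at_withinI[OF this]]
  show ?thesis by (simp add: o_def)
qed

lemma running_cost_nonneg: "0 \<le> h x + w \<bullet> (R *v w)"
  using h_nonneg[of x] sym_pos_def_nonneg[OF R_spd, of w] by simp

text \<open>By the choice of the feedback, \<open>R *v feedback g R v x\<close> is minus one half of
  \<open>transpose (g x) *v gradient v x\<close>; this trades the gradient for the cross term of the
  square to be completed.\<close>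

lemma inner_gradient:
  "(g x *v w) \<bullet> gradient v x = - 2 * (w \<bullet> (R *v feedback g R v x))"
proof -
  define b where "b = transpose (g x) *v gradient v x"
  have "R *v feedback g R v x = (- (1 / 2)) *\<^sub>R ((R ** matrix_inv R) *v b)"
    unfolding feedback_def b_def[symmetric]
    by (simp only: matrix_vector_mult_scaleR matrix_vector_mul_assoc)
  also have "\<dots> = (- (1 / 2)) *\<^sub>R b"
    by (simp only: sym_pos_def_matrix_inv[OF R_spd] matrix_vector_mul_lid)
  finally have "w \<bullet> (R *v feedback g R v x) = - (1 / 2) * (w \<bullet> b)" by simp
  moreover have "(g x *v w) \<bullet> gradient v x = w \<bullet> b"
    unfolding b_def by (simp add: dot_lmul_matrix inner_commute[of w] inner_commute[of "g x *v w"])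
  ultimately show ?thesis by simp
qed

text \<open>Completing the square: the Hamiltonian is minimised exactly by the feedback.\<close>

lemma HJB_square:
  assumes "x \<in> \<Omega>"
  shows "(f x + g x *v w) \<bullet> gradient v x + (h x + w \<bullet> (R *v w))
    = (w - feedback g R v x) \<bullet> (R *v (w - feedback g R v x))"
proof -
  define p where "p = feedback g R v x"
  have "(weighted_norm R p)\<^sup>2 = p \<bullet> (R *v p)"
    by (simp add: weighted_norm_def sym_pos_def_nonneg[OF R_spd])
  then have "f x \<bullet> gradient v x + (g x *v p) \<bullet> gradient v x + h x + p \<bullet> (R *v p) = 0"
    using HJB[OF assms] by (simp add: p_def inner_add_left)
  then have 1: "f x \<bullet> gradient v x = p \<bullet> (R *v p) - h x"
    by (simp add: inner_gradient p_def)
  have "(f x + g x *v w) \<bullet> gradient v x = f x \<bullet> gradient v x - 2 * (w \<bullet> (R *v p))"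
    by (simp add: inner_add_left inner_gradient p_def)
  moreover have "p \<bullet> (R *v w) = w \<bullet> (R *v p)"
    by (rule sym_pos_def_inner_commute[OF R_spd])
  ultimately show ?thesis
    unfolding p_def[symmetric] using 1
    by (simp add: matrix_vector_mult_diff_distrib inner_diff_left inner_diff_right)
qed

lemma HJB_feedback:
  assumes "x \<in> \<Omega>"
  shows "(f x + g x *v feedback g R v x) \<bullet> gradient v x
    = - (h x + feedback g R v x \<bullet> (R *v feedback g R v x))"
  using HJB_square[OF assms, of "feedback g R v x"] by simp

lemma HJB_inequality:
  assumes "x \<in> \<Omega>"
  shows "- ((f x + g x *v w) \<bullet> gradient v x) \<le> h x + w \<bullet> (R *v w)"
  using HJB_square[OF assms, of w] sym_pos_def_nonneg[OF R_spd, of "w - feedback g R v x"] by simp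

lemma continuous_feedback: "continuous_on \<Omega> (feedback g R v)"
proof -
  have "continuous_on \<Omega> (\<lambda>x. transpose (g x))"
    unfolding transpose_def
    by (intro continuous_on_vec_lambda bounded_linear.continuous_on[OF bounded_linear_vec_nth] continuous_g)
  then have "continuous_on \<Omega> (\<lambda>x. transpose (g x) *v gradient v x)"
    by (rule bounded_bilinear.continuous_on[OF bounded_bilinear_matrix_vector_mult _
        C1_on_imp_continuous_on_gradient[OF v_C1]])
  then have "continuous_on \<Omega> (\<lambda>x. matrix_inv R *v (transpose (g x) *v gradient v x))"
    by (rule bounded_bilinear.continuous_on[OF bounded_bilinear_matrix_vector_mult continuous_on_const])
  then have "continuous_on \<Omega> (\<lambda>x. (- (1 / 2)) *\<^sub>R (matrix_inv R *v (transpose (g x) *v gradient v x)))"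
    by (rule continuous_on_scaleR[OF continuous_on_const])
  then show ?thesis by (simp only: feedback_def[abs_def])
qed

text \<open>At a zero \<open>x \<noteq> 0\<close> of \<open>v\<close>, a minimum, the gradient and hence the feedback would vanish.\<close>

lemma v_pos:
  assumes "x \<in> \<Omega>" "x \<noteq> 0"
  shows "0 < v x"
proof (rule ccontr)
  assume "\<not> 0 < v x"
  then have "v x = 0" using v_nonneg[OF assms(1)] by simp
  have "(v has_derivative (\<lambda>w. w \<bullet> gradient v x)) (at x)"
    using GDERIV_v[OF assms(1)] by (simp add: gderiv_def)
  from differential_zero_maxmin[OF assms(1) Omega(1) this]
  have "(\<lambda>w. w \<bullet> gradient v x) = (\<lambda>w. 0)"
    using v_nonneg \<open>v x = 0\<close> by auto
  then have "gradient v x \<bullet> gradient v x = 0" by meson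
  then have "gradient v x = 0" by simp
  then show False
    using HJB_feedback[OF assms(1)] h_pos[OF assms(2)]
      sym_pos_def_nonneg[OF R_spd, of "feedback g R v x"] by simp
qed

section \<open>Upper bound near 0, by running the closed loop\<close>

lemma optimal_value_le:
  obtains \<rho> where "\<rho> > 0" "\<And>x. x \<in> ball 0 \<rho> \<Longrightarrow> optimal_value f g h R x \<le> ennreal (v x)"
proof -
  obtain r where r: "r > 0" "cball 0 r \<subseteq> \<Omega>"
    using Omega open_contains_cball by blast
  have contv: "continuous_on (cball 0 r) v" using continuous_v r(2) by (rule continuous_on_subset)
  \<comment> \<open>The minimum of \<open>v\<close> on the sphere of radius \<open>r\<close> is a
    barrier: a curve along which \<open>v\<close> does not increase, started inside with
    \<open>v x < c\<close>, cannot reach the sphere.\<close>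
  obtain c where c: "c > 0" "\<And>p. norm p = r \<Longrightarrow> c \<le> v p"
  proof -
    have "sphere 0 r \<noteq> ({} :: (real ^ 'n) set)" using r by simp
    from continuous_attains_inf[OF compact_sphere this continuous_on_subset[OF contv]]
    obtain p0 where p0: "p0 \<in> sphere 0 r" "\<forall>p\<in>sphere 0 r. v p0 \<le> v p" by force
    then have "0 < v p0" using r by (intro v_pos) auto
    then show thesis using p0 that[of "v p0"] by auto
  qed
  \<comment> \<open>Peano's theorem asks for a bounded continuous field on the whole space.
    Composing with the nearest-point projection onto the ball provides one that agrees with the
    closed loop inside.\<close>
  define \<pi> where "\<pi> = closest_point (cball (0 :: real ^ 'n) r)"
  define F where "F p = f (\<pi> p) + g (\<pi> p) *v feedback g R v (\<pi> p)" for p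
  have \<pi>: "\<pi> p \<in> cball 0 r" "p \<in> cball 0 r \<Longrightarrow> \<pi> p = p" for p
    unfolding \<pi>_def using r closest_point_in_set[of "cball 0 r" p] by (simp_all add: closest_point_self)
  have cont_\<pi>: "continuous_on S \<pi>" for S
    unfolding \<pi>_def using r by (intro continuous_on_closest_point) auto
  have fb: "continuous_on (cball 0 r) (feedback g R v)"
    using continuous_feedback r(2) by (rule continuous_on_subset)
  have contF0: "continuous_on (cball 0 r) (\<lambda>p. f p + g p *v feedback g R v p)"
    by (intro continuous_on_add continuous_f
        bounded_bilinear.continuous_on[OF bounded_bilinear_matrix_vector_mult] continuous_g fb)
  have contF: "continuous_on UNIV F"
    unfolding F_def by (rule continuous_on_compose2[OF contF0 cont_\<pi>]) (use \<pi> in auto)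
  obtain B where B: "\<And>p. norm (F p) \<le> B"
  proof -
    have "bounded ((\<lambda>p. f p + g p *v feedback g R v p) ` cball 0 r)"
      by (intro compact_imp_bounded compact_continuous_image contF0 compact_cball)
    then obtain B where "\<forall>p\<in>cball 0 r. norm (f p + g p *v feedback g R v p) \<le> B"
      unfolding bounded_iff by blast
    then show thesis using that[of B] \<pi>(1) by (simp add: F_def)
  qed
  have B0: "B \<ge> 0" using B[of 0] norm_ge_zero order_trans by blast
  have main: "optimal_value f g h R x \<le> ennreal (v x)" if x: "norm x < r" "v x < c" for x
  proof -
    obtain y where y0: "y 0 = x" and Lip: "\<And>s t. norm (y s - y t) \<le> B * \<bar>s - t\<bar>"
      and der: "\<And>t. t > 0 \<Longrightarrow> (y has_vector_derivative F (y t)) (at t)"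
      using Peano_existence[OF contF B, of x] by blast
    have conty: "continuous_on S y" for S
      by (rule lipschitz_on_continuous_on[of B], rule lipschitz_onI) (auto simp: dist_norm Lip B0)
    define u where "u t = feedback g R v (y t)" for t
    define k where "k t = h (y t) + u t \<bullet> (R *v u t)" for t
    have k0: "k t \<ge> 0" for t unfolding k_def by (rule running_cost_nonneg)
    have v_der: "((\<lambda>t. v (y t)) has_vector_derivative - k t) (at t)"
      if "t > 0" "y t \<in> cball 0 r" for t
    proof -
      have "y t \<in> \<Omega>" using that r by auto
      from vector_derivative_v[OF this der[OF that(1)]] show ?thesis
        using HJB_feedback[OF \<open>y t \<in> \<Omega>\<close>] \<pi>(2)[OF that(2)] by (simp add: F_def k_def u_def)
    qed
    have contvy: "continuous_on {0..b} (\<lambda>t. v (y t))" if "\<And>t. t \<in> {0..b} \<Longrightarrow> y t \<in> cball 0 r" for b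
      by (rule continuous_on_compose2[OF contv conty]) (use that in blast)
    have inside: "y t \<in> cball 0 r" if "t \<ge> 0" for t
    proof (rule ccontr)
      assume "y t \<notin> cball 0 r"
      moreover have "continuous_on {0..t} (\<lambda>t. norm (y t))"
        by (intro continuous_on_norm conty)
      ultimately obtain \<tau> where \<tau>: "0 < \<tau>" "norm (y \<tau>) = r" "\<And>s. 0 \<le> s \<Longrightarrow> s < \<tau> \<Longrightarrow> norm (y s) < r"
        using first_hitting_time[of 0 t "\<lambda>t. norm (y t)" r] y0 x \<open>t \<ge> 0\<close> by auto
      have in\<tau>: "y s \<in> cball 0 r" if "s \<in> {0..\<tau>}" for s
        using \<tau>(2) \<tau>(3)[of s] that by (cases "s = \<tau>") auto
      have "v (y \<tau>) \<le> v (y 0)"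
      proof (rule DERIV_nonpos_imp_decreasing_open[of 0 \<tau> "\<lambda>t. v (y t)"])
        fix s assume "0 < s" "s < \<tau>"
        then have "((\<lambda>t. v (y t)) has_real_derivative - k s) (at s)"
          using v_der[of s] in\<tau>[of s] by (simp add: has_real_derivative_iff_has_vector_derivative)
        then show "\<exists>d. ((\<lambda>t. v (y t)) has_real_derivative d) (at s) \<and> d \<le> 0"
          using k0[of s] by (intro exI[of _ "- k s"]) auto
      qed (use \<tau> in\<tau> contvy in auto)
      then show False using c(2)[OF \<tau>(2)] x y0 by simp
    qed
    have contu: "continuous_on {0..} u"
      unfolding u_def by (rule continuous_on_compose2[OF fb conty]) (use inside in auto)
    have adm: "u \<in> admissible_controls"
    proof -
      have "bounded (feedback g R v ` cball 0 r)"
        by (intro compact_imp_bounded compact_continuous_image fb compact_cball)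
      then obtain C where "\<forall>p\<in>cball 0 r. norm (feedback g R v p) \<le> C"
        unfolding bounded_iff by blast
      then have "AE t in lebesgue_on {0..}. norm (u t) \<le> C"
        using inside by (intro AE_I2) (simp add: u_def)
      then show ?thesis
        unfolding admissible_controls_def
        using continuous_imp_measurable_on_sets_lebesgue[OF contu] by auto
    qed
    have sol: "carath_solution f g u x \<infinity> y"
      unfolding carath_solution_def
    proof (intro conjI allI impI y0)
      show "abs_continuous_on 0 b y" for b
        by (rule Lipschitz_imp_abs_continuous_on[OF B0 Lip])
      have "(y has_vector_derivative f (y t) + g (y t) *v u t) (at t)" if "t > 0" for t
        using der[OF that] \<pi>(2)[OF inside] that by (simp add: F_def u_def)
      then have "t > 0 \<longrightarrow> (y has_vector_derivative f (y t) + g (y t) *v u t) (at t)" for t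
        by blast
      \<comment> \<open>Time 0, where Peano's theorem gives no two-sided derivative, is discarded as
        a null set.\<close>
      moreover have "AE t in lebesgue. t \<notin> {0 :: real}"
        by (rule AE_not_in) (simp flip: negligible_iff_null_sets)
      ultimately have "AE t in lebesgue. 0 \<le> t \<and> ereal t < \<infinity> \<longrightarrow>
          (y has_vector_derivative f (y t) + g (y t) *v u t) (at t)"
        by (auto elim!: eventually_mono)
      then show "AE t in lebesgue_on {t. 0 \<le> t \<and> ereal t < \<infinity>}.
          (y has_vector_derivative f (y t) + g (y t) *v u t) (at t)"
        using time_interval_lebesgue[of \<infinity>] by (simp add: AE_restrict_space_iff)
    qed simp
    have "optimal_value f g h R x \<le> cost f g h R x u"
      unfolding optimal_value_def by (rule INF_lower[OF adm])
    also have "\<dots> = (\<integral>\<^sup>+ t. ennreal (k t) \<partial>lebesgue_on {0..})"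
      unfolding k_def by (rule cost_eq[OF f_C1 g_C1 adm sol])
    also have "\<dots> \<le> ennreal (v x)"
    proof (rule nn_integral_half_line_le)
      \<comment> \<open>Along the closed loop the running cost is exactly the rate of decrease of
        \<open>v\<close>; dropping the nonnegative end value gives the bound \<open>v x\<close> on
        every horizon.\<close>
      show "(k has_integral v x - v (y (real n))) {0..real n}" for n
      proof -
        have "((\<lambda>t. - k t) has_integral v (y (real n)) - v (y 0)) {0..real n}"
          by (rule fundamental_theorem_of_calculus_interior)
            (use contvy inside v_der in auto)
        from has_integral_neg[OF this] show ?thesis by (simp add: y0)
      qed
      show "v x - v (y (real n)) \<le> v x" for n
        using v_nonneg[of "y (real n)"] inside[of "real n"] r by auto
    qed (rule k0)
    finally show ?thesis .
  qed
  have "continuous_on (ball 0 r) v" using contv by (rule continuous_on_subset) auto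
  then have "open (ball 0 r \<inter> v -` {..<c})"
    by (rule continuous_open_preimage) auto
  moreover have "0 \<in> ball 0 r \<inter> v -` {..<c}" using r c v_0 by simp
  ultimately obtain \<rho> where \<rho>: "\<rho> > 0" "ball 0 \<rho> \<subseteq> ball 0 r \<inter> v -` {..<c}"
    by (rule openE)
  show thesis
  proof (rule that[OF \<rho>(1)])
    fix x assume "x \<in> ball (0 :: real ^ 'n) \<rho>"
    then have "x \<in> ball 0 r \<inter> v -` {..<c}" using \<rho>(2) by (rule subsetD[rotated])
    then show "optimal_value f g h R x \<le> ennreal (v x)" by (intro main) auto
  qed
qed

section \<open>Lower bound near 0, for arbitrary controls\<close>

lemma running_cost_measurable:
  assumes u: "u \<in> admissible_controls" and y: "carath_solution f g u x \<infinity> y" and "0 \<le> a"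
  shows "(\<lambda>t. h (y t) + u t \<bullet> (R *v u t)) \<in> borel_measurable (lebesgue_on {a..b})"
proof -
  have "continuous_on {a..b} y"
    by (rule abs_continuous_on_imp_continuous_on[OF carath_solution_abs_continuous[OF y \<open>0 \<le> a\<close>]]) simp
  then have "continuous_on {a..b} (\<lambda>t. h (y t))"
    by (rule continuous_on_compose2[OF continuous_h[of UNIV]]) simp
  then have hy: "(\<lambda>t. h (y t)) \<in> borel_measurable (lebesgue_on {a..b})"
    by (rule continuous_imp_measurable_on_sets_lebesgue) simp
  have "u \<in> borel_measurable (lebesgue_on {0..})"
    using u by (simp add: admissible_controls_def)
  then have um: "u \<in> borel_measurable (lebesgue_on {a..b})"
    by (rule measurable_restrict_mono) (use \<open>0 \<le> a\<close> in auto)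
  have "continuous_on UNIV (\<lambda>w. w \<bullet> (R *v w))"
    by (intro continuous_intros)
  then have "(\<lambda>w. w \<bullet> (R *v w)) \<in> borel_measurable borel"
    by (rule borel_measurable_continuous_onI)
  from measurable_compose[OF um this] show ?thesis
    by (intro borel_measurable_add hy)
qed

lemma cost_ge_on_interval:
  assumes u: "u \<in> admissible_controls" and y: "carath_solution f g u x \<infinity> y" and "0 \<le> a"
  shows "(\<integral>\<^sup>+ t. ennreal (h (y t) + u t \<bullet> (R *v u t)) \<partial>lebesgue_on {a..b}) \<le> cost f g h R x u"
  unfolding cost_eq[OF f_C1 g_C1 u y]
  by (rule nn_integral_lebesgue_on_mono) (use \<open>0 \<le> a\<close> in auto)

text \<open>Away from 0, \<open>h\<close> has a positive minimum \<open>m\<close> on the compact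
  set, which absorbs the part of the speed independent of \<open>w\<close>; the linear part is
  absorbed by the coercive quadratic form through
  \<open>norm w \<le> 1 + (norm w)\<^sup>2\<close>.\<close>

lemma speed_le_running_cost:
  assumes A: "compact A" "0 \<notin> A"
  obtains C where "C > 0" "\<And>p w. p \<in> A \<Longrightarrow> norm (f p + g p *v w) \<le> C * (h p + w \<bullet> (R *v w))"
proof (cases "A = {}")
  case False
  from continuous_attains_inf[OF A(1) False continuous_h]
  obtain p0 where p0: "p0 \<in> A" "\<And>p. p \<in> A \<Longrightarrow> h p0 \<le> h p" by blast
  define m where "m = h p0"
  have m: "m > 0" "\<And>p. p \<in> A \<Longrightarrow> m \<le> h p"
    using p0 A(2) h_pos[of p0] by (auto simp: m_def)
  have "bounded (f ` A)"
    by (intro compact_imp_bounded compact_continuous_image continuous_f A)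
  then obtain a where a: "a > 0" "\<And>p. p \<in> A \<Longrightarrow> norm (f p) \<le> a"
    unfolding bounded_pos by blast
  have "bounded (g ` A)"
    by (intro compact_imp_bounded compact_continuous_image continuous_g A)
  then obtain b where b: "b > 0" "\<And>p. p \<in> A \<Longrightarrow> norm (g p) \<le> b"
    unfolding bounded_pos by blast
  obtain K where K: "K > 0" "\<And>(M :: real ^ 'm ^ 'n) w. norm (M *v w) \<le> norm M * norm w * K"
    using bounded_bilinear.pos_bounded[OF bounded_bilinear_matrix_vector_mult] by blast
  obtain c where c: "c > 0" "\<And>w. c * (norm w)\<^sup>2 \<le> w \<bullet> (R *v w)"
    using sym_pos_def_coercive[OF R_spd] by blast
  \<comment> \<open>Chosen so that \<open>C1 * m = a + b * K\<close> and
    \<open>C2 * c = b * K\<close>, the two coefficients of the speed bound.\<close>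
  define C1 C2 where "C1 = (a + b * K) / m" and "C2 = b * K / c"
  have C: "C1 > 0" "C2 > 0" using a b c m K by (auto simp: C1_def C2_def add_pos_pos)
  show thesis
  proof (rule that[of "C1 + C2"])
    fix p and w :: "real ^ 'm" assume p: "p \<in> A"
    have w: "norm w \<le> 1 + (norm w)\<^sup>2"
      using sum_power2_ge_zero[of "norm w - 1 / 2" 0] by (simp add: power2_eq_square algebra_simps)
    have "norm (f p + g p *v w) \<le> norm (f p) + norm (g p *v w)"
      by (rule norm_triangle_ineq)
    also have "\<dots> \<le> a + b * (1 + (norm w)\<^sup>2) * K"
    proof (rule add_mono[OF a(2)[OF p]])
      have "norm (g p *v w) \<le> norm (g p) * norm w * K" by (rule K(2))
      also have "\<dots> \<le> b * (1 + (norm w)\<^sup>2) * K"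
        using b p w K(1) by (intro mult_right_mono mult_mono) auto
      finally show "norm (g p *v w) \<le> b * (1 + (norm w)\<^sup>2) * K" .
    qed
    also have "\<dots> = C1 * m + C2 * (c * (norm w)\<^sup>2)"
    proof -
      have "C1 * m = a + b * K" "C2 * c = b * K" using m c by (simp_all add: C1_def C2_def)
      then have "C1 * m + (C2 * c) * (norm w)\<^sup>2 = a + b * (1 + (norm w)\<^sup>2) * K"
        by (simp only: algebra_simps)
      then show ?thesis by (simp only: mult.assoc)
    qed
    also have "\<dots> \<le> C1 * h p + C2 * (w \<bullet> (R *v w))"
      using C m(2)[OF p] c(2)[of w] by (intro add_mono mult_left_mono) auto
    also have "\<dots> \<le> (C1 + C2) * (h p + w \<bullet> (R *v w))"
      using C h_nonneg[of p] sym_pos_def_nonneg[OF R_spd, of w] by (simp add: algebra_simps)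
    finally show "norm (f p + g p *v w) \<le> (C1 + C2) * (h p + w \<bullet> (R *v w))" .
  qed (use C in simp)
qed (use that[of 1] in simp)

text \<open>While the path crosses the annulus it is displaced by at least \<open>r / 2\<close>, and
  its speed is at most \<open>C\<close> times the running cost, so the integral of the latter is at
  least \<open>r / 2 / C\<close>.\<close>

lemma cost_ge_of_crossing:
  assumes u: "u \<in> admissible_controls" and y: "carath_solution f g u x \<infinity> y"
    and C: "C > 0" "\<And>p w. r / 2 \<le> norm p \<Longrightarrow> norm p \<le> r \<Longrightarrow>
      norm (f p + g p *v w) \<le> C * (h p + w \<bullet> (R *v w))"
    and r: "r > 0" "norm x < r / 2" "0 \<le> b" "r \<le> norm (y b)"
  shows "ennreal (r / 2 / C) \<le> cost f g h R x u"
proof -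
  have "continuous_on {0..b} y"
    by (rule abs_continuous_on_imp_continuous_on[OF carath_solution_abs_continuous[OF y]]) auto
  then have cont: "continuous_on {0..b} (\<lambda>t. norm (y t))" by (rule continuous_on_norm)
  have "norm (y 0) < r / 2" using y r(2) by (simp add: carath_solution_def)
  moreover have "r / 2 < r" using r(1) by simp
  ultimately obtain s t where st: "0 \<le> s" "s < t" "norm (y s) = r / 2" "norm (y t) = r"
    "\<And>q. s \<le> q \<Longrightarrow> q \<le> t \<Longrightarrow> r / 2 \<le> norm (y q) \<and> norm (y q) \<le> r"
    using crossing_interval[OF cont r(3) _ _ r(4)] by blast
  have "((\<lambda>q. (1 / C) *\<^sub>R (f (y q) + g (y q) *v u q)) has_integral (1 / C) *\<^sub>R (y t - y s)) {s..t}"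
    by (intro has_integral_cmul carath_solution_has_integral[OF y]) (use st in auto)
  then have "ennreal (norm ((1 / C) *\<^sub>R (y t - y s)))
      \<le> (\<integral>\<^sup>+ t. ennreal (h (y t) + u t \<bullet> (R *v u t)) \<partial>lebesgue_on {s..t})"
  proof (rule norm_has_integral_le_nn_integral[where N = "{}"])
    show "norm ((1 / C) *\<^sub>R (f (y q) + g (y q) *v u q)) \<le> h (y q) + u q \<bullet> (R *v u q)"
      if "q \<in> {s..t} - {}" for q
      using C(2)[of "y q" "u q"] st(5)[of q] that C(1)
      by (simp add: pos_divide_le_eq mult.commute[of _ C])
  qed (simp_all add: running_cost_measurable[OF u y st(1)] running_cost_nonneg)
  also have "\<dots> \<le> cost f g h R x u" by (rule cost_ge_on_interval[OF u y st(1)])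
  finally have le: "ennreal (norm ((1 / C) *\<^sub>R (y t - y s))) \<le> cost f g h R x u" .
  have "r / 2 \<le> norm (y t - y s)"
    using norm_triangle_ineq2[of "y t" "y s"] st by simp
  then have "r / 2 / C \<le> norm ((1 / C) *\<^sub>R (y t - y s))"
    using divide_right_mono[of "r / 2" _ C] C(1) by simp
  from order_trans[OF ennreal_leI[OF this] le] show ?thesis .
qed

text \<open>On the ball \<open>v\<close> is Lipschitz, so \<open>v (y t)\<close> is absolutely
  continuous and is the integral of its almost-everywhere derivative; by
  \<open>HJB_inequality\<close> it decreases no faster than cost accrues.\<close>

lemma v_decrease_le_cost:
  assumes u: "u \<in> admissible_controls" and y: "carath_solution f g u x \<infinity> y"
    and r: "cball 0 r \<subseteq> \<Omega>" and inside: "\<And>t. t \<ge> 0 \<Longrightarrow> y t \<in> cball 0 r" and b: "0 \<le> b"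
  shows "ennreal (v x - v (y b)) \<le> cost f g h R x u"
proof -
  obtain L where L: "L \<ge> 0" "\<And>p q. p \<in> cball 0 r \<Longrightarrow> q \<in> cball 0 r \<Longrightarrow> norm (v p - v q) \<le> L * norm (p - q)"
    using C1_on_imp_Lipschitz[OF v_C1 compact_cball convex_cball r] by blast
  obtain N where N: "negligible N"
    "\<And>t. 0 \<le> t \<Longrightarrow> ereal t < \<infinity> \<Longrightarrow> t \<notin> N \<Longrightarrow> (y has_vector_derivative f (y t) + g (y t) *v u t) (at t)"
    using carath_solution_derivative[OF y] by blast
  have "abs_continuous_on 0 b y"
    by (rule carath_solution_abs_continuous[OF y]) auto
  then have ac: "abs_continuous_on 0 b (\<lambda>t. v (y t))"
    by (rule abs_continuous_on_dominated[OF _ L(1)]) (use L(2) inside in auto)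
  have int': "((\<lambda>t. (f (y t) + g (y t) *v u t) \<bullet> gradient v (y t)) has_integral v (y b) - v (y 0)) {0..b}"
  proof (rule abs_continuous_on_has_integral[OF b ac N(1)])
    fix t assume t: "t \<in> {0..b} - N"
    then have "y t \<in> \<Omega>" using inside[of t] r by auto
    then show "((\<lambda>t. v (y t)) has_vector_derivative (f (y t) + g (y t) *v u t) \<bullet> gradient v (y t)) (at t within {0..b})"
      by (rule has_vector_derivative_at_within[OF vector_derivative_v[where y = y]]) (use t N(2)[of t] in auto)
  qed
  have "y 0 = x" using y by (simp add: carath_solution_def)
  with has_integral_neg[OF int'] have int: "((\<lambda>t. - ((f (y t) + g (y t) *v u t) \<bullet> gradient v (y t))) has_integral v x - v (y b)) {0..b}"
    by simp
  have "ennreal (v x - v (y b)) \<le> (\<integral>\<^sup>+ t. ennreal (h (y t) + u t \<bullet> (R *v u t)) \<partial>lebesgue_on {0..b})"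
  proof (rule has_integral_le_nn_integral[OF int, of "{}"])
    fix t assume "t \<in> {0..b} - {}"
    then have "y t \<in> \<Omega>" using inside[of t] r by auto
    then show "- ((f (y t) + g (y t) *v u t) \<bullet> gradient v (y t)) \<le> h (y t) + u t \<bullet> (R *v u t)"
      by (rule HJB_inequality)
  qed (simp_all add: running_cost_measurable[OF u y] running_cost_nonneg)
  also have "\<dots> \<le> cost f g h R x u" by (rule cost_ge_on_interval[OF u y]) simp
  finally show ?thesis .
qed

text \<open>
  If a trajectory confined to a ball had cost below \<open>v x\<close>, then \<open>v\<close> would stay away from \<open>0\<close>
  along it, hence so would the state and the running cost \<open>h\<close>, and the cost would be infinite.
\<close>

lemma v_le_cost_of_confined:
  assumes u: "u \<in> admissible_controls" and y: "carath_solution f g u x \<infinity> y"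
    and r: "r > 0" "cball 0 r \<subseteq> \<Omega>" and inside: "\<And>t. t \<ge> 0 \<Longrightarrow> y t \<in> cball 0 r"
  shows "ennreal (v x) \<le> cost f g h R x u"
proof (rule ccontr)
  assume "\<not> ennreal (v x) \<le> cost f g h R x u"
  then have less: "cost f g h R x u < ennreal (v x)" by simp
  define c where "c = enn2real (cost f g h R x u)"
  have c: "cost f g h R x u = ennreal c" "0 \<le> c"
  proof -
    have "cost f g h R x u < top" using less ennreal_less_top by (rule order.strict_trans)
    then show "cost f g h R x u = ennreal c" unfolding c_def by (rule ennreal_enn2real[symmetric])
  qed (simp add: c_def)
  then have "c < v x" using less by (simp add: ennreal_less_iff)
  have large: "v x - c \<le> v (y t)" if "t \<ge> 0" for t
    using v_decrease_le_cost[OF u y r(2) inside that] c by (simp add: ennreal_le_iff)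
  have "continuous_on (ball 0 r) v"
    using continuous_v by (rule continuous_on_subset) (use r in auto)
  then have "open (ball 0 r \<inter> v -` {..<v x - c})"
    by (rule continuous_open_preimage) auto
  moreover have "0 \<in> ball 0 r \<inter> v -` {..<v x - c}" using r v_0 \<open>c < v x\<close> by simp
  ultimately obtain \<epsilon> where \<epsilon>: "\<epsilon> > 0" "ball 0 \<epsilon> \<subseteq> ball 0 r \<inter> v -` {..<v x - c}"
    by (rule openE)
  define A where "A = cball (0 :: real ^ 'n) r - ball 0 \<epsilon>"
  have inA: "y t \<in> A" if "t \<ge> 0" for t
  proof -
    have "y t \<notin> ball 0 \<epsilon>"
    proof
      assume "y t \<in> ball 0 \<epsilon>"
      then have "y t \<in> ball 0 r \<inter> v -` {..<v x - c}" using \<epsilon>(2) by (rule subsetD[rotated])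
      then show False using large[OF that] by simp
    qed
    then show ?thesis using inside[OF that] by (simp add: A_def)
  qed
  have "compact A" unfolding A_def by (intro compact_diff compact_cball open_ball)
  moreover have "A \<noteq> {}" using inA[of 0] by auto
  ultimately have "\<exists>p0\<in>A. \<forall>p\<in>A. h p0 \<le> h p"
    by (rule continuous_attains_inf[OF _ _ continuous_h])
  then obtain p0 where p0: "p0 \<in> A" "\<forall>p\<in>A. h p0 \<le> h p" by blast
  then have m: "h p0 > 0" using \<epsilon>(1) by (intro h_pos) (auto simp: A_def)
  \<comment> \<open>On \<open>A\<close> the running cost is at least \<open>h p0\<close>, so a
    horizon \<open>n\<close> with \<open>real n * h p0 > c\<close> already exceeds the total
    cost.\<close>
  obtain n where n: "c < real n * h p0" using reals_Archimedean3[OF m] by blast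
  have "((\<lambda>t. h p0) has_integral real n * h p0) {0..real n}"
    using has_integral_const_real[of "h p0" 0 "real n"] by simp
  then have "ennreal (real n * h p0) \<le> (\<integral>\<^sup>+ t. ennreal (h (y t) + u t \<bullet> (R *v u t)) \<partial>lebesgue_on {0..real n})"
  proof (rule has_integral_le_nn_integral[where N = "{}"])
    fix t assume "t \<in> {0..real n} - {}"
    then have "h p0 \<le> h (y t)" using p0(2) inA[of t] by simp
    then show "h p0 \<le> h (y t) + u t \<bullet> (R *v u t)"
      using sym_pos_def_nonneg[OF R_spd, of "u t"] by simp
  qed (simp_all add: running_cost_measurable[OF u y] running_cost_nonneg)
  also have "\<dots> \<le> ennreal c" unfolding c(1)[symmetric] by (rule cost_ge_on_interval[OF u y]) simp
  finally show False using n c(2) by (simp add: ennreal_le_iff)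
qed

lemma le_optimal_value:
  obtains \<rho> where "\<rho> > 0" "\<And>x. x \<in> ball 0 \<rho> \<Longrightarrow> ennreal (v x) \<le> optimal_value f g h R x"
proof -
  obtain r where r: "r > 0" "cball 0 r \<subseteq> \<Omega>"
    using Omega open_contains_cball by blast
  have A: "compact (cball (0 :: real ^ 'n) r - ball 0 (r / 2))"
    by (intro compact_diff compact_cball open_ball)
  have A': "0 \<notin> cball (0 :: real ^ 'n) r - ball 0 (r / 2)" using r by simp
  obtain C where C: "C > 0" "\<And>p w. p \<in> cball 0 r - ball 0 (r / 2) \<Longrightarrow>
      norm (f p + g p *v w) \<le> C * (h p + w \<bullet> (R *v w))"
    using speed_le_running_cost[OF A A'] by blast
  have "continuous_on (ball 0 (r / 2)) v"
    using continuous_v by (rule continuous_on_subset) (use r in auto)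
  \<comment> \<open>The threshold is the price of crossing the annulus; keeping \<open>v x\<close>
    below it settles every control whose global trajectory leaves the large ball.\<close>
  then have "open (ball 0 (r / 2) \<inter> v -` {..<r / 2 / C})"
    by (rule continuous_open_preimage) auto
  moreover have "0 \<in> ball 0 (r / 2) \<inter> v -` {..<r / 2 / C}" using r C v_0 by simp
  ultimately obtain \<rho> where \<rho>: "\<rho> > 0" "ball 0 \<rho> \<subseteq> ball 0 (r / 2) \<inter> v -` {..<r / 2 / C}"
    by (rule openE)
  have "ennreal (v x) \<le> optimal_value f g h R x" if "x \<in> ball 0 \<rho>" for x
    unfolding optimal_value_def
  proof (rule INF_greatest)
    fix u :: "real \<Rightarrow> real ^ 'm" assume u: "u \<in> admissible_controls"
    have "x \<in> ball 0 (r / 2) \<inter> v -` {..<r / 2 / C}" using \<rho>(2) that by (rule subsetD)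
    then have x: "norm x < r / 2" "v x < r / 2 / C" by auto
    show "ennreal (v x) \<le> cost f g h R x u"
    proof (cases "\<exists>y. carath_solution f g u x \<infinity> y")
      case True
      then obtain y where y: "carath_solution f g u x \<infinity> y" by blast
      show ?thesis
      proof (cases "\<forall>t\<ge>0. y t \<in> cball 0 r")
        case True
        then show ?thesis by (intro v_le_cost_of_confined[OF u y r]) simp
      next
        case False
        then obtain b where b: "b \<ge> 0" "r \<le> norm (y b)" by auto
        have "ennreal (r / 2 / C) \<le> cost f g h R x u"
          by (rule cost_ge_of_crossing[OF u y C(1) _ r(1) x(1) b]) (rule C(2), simp)
        moreover have "ennreal (v x) \<le> ennreal (r / 2 / C)"
          using x(2) by (intro ennreal_leI) simp
        ultimately show ?thesis by (rule order_trans[rotated])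
      qed
    next
      case False
      then show ?thesis by (simp add: cost_eq_infinity)
    qed
  qed
  with \<rho>(1) show thesis by (rule that)
qed

end

theorem corollary2p2:
  fixes f :: "real ^ 'n \<Rightarrow> real ^ 'n"
    and g :: "real ^ 'n \<Rightarrow> real ^ 'm ^ 'n"
    and h :: "real ^ 'n \<Rightarrow> real"
    and R :: "real ^ 'm ^ 'm"
    and \<Omega> :: "(real ^ 'n) set"
    and v :: "real ^ 'n \<Rightarrow> real"
  assumes f_C1: "C1_on f UNIV"
    and g_C1: "C1_on g UNIV"
    and h_C1: "C1_on h UNIV"
    and R_spd: "sym_pos_def R"
    and f_0: "f 0 = 0"
    and h_0: "h 0 = 0"
    and h_pos: "\<And>x. x \<noteq> 0 \<Longrightarrow> 0 < h x"
    and dom: "open \<Omega>" "connected \<Omega>" "0 \<in> \<Omega>"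
    and vstar_finite: "\<And>x. x \<in> \<Omega> \<Longrightarrow> optimal_value f g h R x < \<infinity>"
    and vstar_analytic: "real_analytic_on (\<lambda>x. enn2real (optimal_value f g h R x)) \<Omega>"
    and v_C1: "C1_on v \<Omega>"
    and v_nonneg: "\<And>x. x \<in> \<Omega> \<Longrightarrow> 0 \<le> v x"
    and v_0: "v 0 = 0"
    and HJB: "\<And>x. x \<in> \<Omega> \<Longrightarrow>
      (f x + g x *v feedback g R v x) \<bullet> gradient v x + h x
        + (weighted_norm R (feedback g R v x))\<^sup>2 = 0"
    and v_analytic: "real_analytic_on v \<Omega>"
  shows "\<forall>x\<in>\<Omega>. optimal_value f g h R x = ennreal (v x)"
proof
  fix x assume x: "x \<in> \<Omega>"
  interpret hjb_solution f g h R \<Omega> v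
    by unfold_locales (rule assms; assumption)+
  obtain \<rho>1 where \<rho>1: "\<rho>1 > 0" "\<And>x. x \<in> ball 0 \<rho>1 \<Longrightarrow> optimal_value f g h R x \<le> ennreal (v x)"
    using optimal_value_le by blast
  obtain \<rho>2 where \<rho>2: "\<rho>2 > 0" "\<And>x. x \<in> ball 0 \<rho>2 \<Longrightarrow> ennreal (v x) \<le> optimal_value f g h R x"
    using le_optimal_value by blast
  have "v x - enn2real (optimal_value f g h R x) = 0"
  proof (rule real_analytic_on_eq_zero[OF real_analytic_on_diff[OF v_analytic vstar_analytic] dom])
    show "0 < min \<rho>1 \<rho>2" using \<rho>1 \<rho>2 by simp
    fix z assume z: "z \<in> \<Omega>" "z \<in> ball 0 (min \<rho>1 \<rho>2)"
    then have "optimal_value f g h R z = ennreal (v z)"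
      using \<rho>1(2)[of z] \<rho>2(2)[of z] by (intro antisym) auto
    then show "v z - enn2real (optimal_value f g h R z) = 0"
      using v_nonneg[OF z(1)] by simp
  qed (rule x)
  then have "v x = enn2real (optimal_value f g h R x)" by simp
  \<comment> \<open>\<open>enn2real\<close> maps infinity to 0, so finiteness on
    \<open>\<Omega>\<close> is what lifts the real equation back to \<open>ennreal\<close>.\<close>
  then show "optimal_value f g h R x = ennreal (v x)"
    using vstar_finite[OF x] by simp
qed

end
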